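(* Let $\Bbbk$ be an infinite field of characteristic $2$, let $G$ be a cyclic group of order $2^r$ with $r\geq 1$, and let $V=V_t$ be the indecomposable $\Bbbk G$-module of dimension $t\leq 2^r$, where $t$ is odd, and assume that $G$ acts faithfully on $V$. Then $$\operatorname{depth}(R^G_{\{1\}})=\dim(V^G),$$ where $R^G_{\{1\}}=\Bbbk[V]^G/\mathrm{Tr}^G(\Bbbk[V])$.
   Context: Fix a generator $\sigma$ of $G$. $V_t$ denotes the indecomposable $\Bbbk G$-module of dimension $t$ on which $\sigma$ acts by a single Jordan block: it has a basis $e_1,\dots,e_t$ with $\sigma(e_1)=e_1$ and $\sigma(e_i)=e_i+e_{i-1}$ for $2\leq i\leq t$. $\Bbbk[V]=S(V^* )$ is the symmetric algebra of $V^*$, with $G$ acting via $g(f)=f\circ g^{-1}$; $\Bbbk[V]^G$ is the ring of invariants and $V^G$ the subspace of $G$-fixed vectors. The transfer is $\mathrm{Tr}^G:\Bbbk[V]\to\Bbbk[V]^G$, $f\mapsto\sum_{g\in G}gf$; its image is an ideal of $\Bbbk[V]^G$. The depth of a Noetherian commutative graded $\Bbbk$-algebra $A=\bigoplus_{i\ge0}A_i$ with $A_0=\Bbbk$ is the length of a maximal $A$-regular sequence contained in $A_+=\bigoplus_{i\ge1}A_i$. *)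

theory Defs
  imports
    "Jordan_Normal_Form.Jordan_Normal_Form"
    "Jordan_Normal_Form.VS_Connect"
    "HOL-Algebra.QuotRing"
    "HOL-Algebra.Generated_Groups"
    "HOL-Library.Poly_Mapping"
begin

section \<open>Depth of a graded ring\<close>

text \<open>A grading of a ring is given by the family of its homogeneous components.\<close>

definition irrelevant_part :: "('a, 'b) ring_scheme \<Rightarrow> (nat \<Rightarrow> 'a set) \<Rightarrow> 'a set" where
  "irrelevant_part A gr =
     {finsum A a {1..n} | a n. \<forall>i\<in>{1..n}. a i \<in> gr i}"

definition regular_sequence :: "('a, 'b) ring_scheme \<Rightarrow> 'a list \<Rightarrow> bool" where
  "regular_sequence A xs \<longleftrightarrow>
     set xs \<subseteq> carrier A \<and>
     (\<forall>k<length xs. \<forall>y\<in>carrier A.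
        (xs ! k) \<otimes>\<^bsub>A\<^esub> y \<in> genideal A (set (take k xs)) \<longrightarrow>
        y \<in> genideal A (set (take k xs))) \<and>
     genideal A (set xs) \<noteq> carrier A"

definition maximal_regular_sequence_in :: "('a, 'b) ring_scheme \<Rightarrow> 'a set \<Rightarrow> 'a list \<Rightarrow> bool" where
  "maximal_regular_sequence_in A J xs \<longleftrightarrow>
     regular_sequence A xs \<and> set xs \<subseteq> J \<and>
     (\<forall>y\<in>J. \<not> regular_sequence A (xs @ [y]))"

text \<open>For Noetherian graded rings with \<open>A\<^sub>0\<close> a field, all maximal regular sequences in the
  irrelevant ideal have the same length, so the description below denotes.\<close>

definition graded_depth :: "('a, 'b) ring_scheme \<Rightarrow> (nat \<Rightarrow> 'a set) \<Rightarrow> nat" where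
  "graded_depth A gr =
     (THE d. \<exists>xs. maximal_regular_sequence_in A (irrelevant_part A gr) xs \<and> length xs = d)"


section \<open>Polynomials in the coordinates of \<open>k\<^sup>t\<close>\<close>

text \<open>The symmetric algebra of the dual of \<open>V = k\<^sup>t\<close> is the polynomial ring in the basis
  \<open>x\<^sub>0, \<dots>, x\<^bsub>t-1\<^esub>\<close> of \<open>V\<^sup>*\<close> dual to the unit vectors; monomials are finitely supported
  exponent functions.\<close>

type_synonym 'k mpoly = "(nat \<Rightarrow>\<^sub>0 nat) \<Rightarrow>\<^sub>0 'k"

definition coord :: "nat \<Rightarrow> 'k::comm_ring_1 mpoly" where
  "coord i = Poly_Mapping.single (Poly_Mapping.single i 1) 1"

definition const :: "'k::comm_ring_1 \<Rightarrow> 'k mpoly" where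
  "const c = Poly_Mapping.single 0 c"

definition polys :: "nat \<Rightarrow> 'k::comm_ring_1 mpoly set" where
  "polys t = {f. \<forall>m\<in>Poly_Mapping.keys f. Poly_Mapping.keys m \<subseteq> {..<t}}"

definition homogeneous :: "nat \<Rightarrow> 'k::comm_ring_1 mpoly \<Rightarrow> bool" where
  "homogeneous d f \<longleftrightarrow> (\<forall>m\<in>Poly_Mapping.keys f. (\<Sum>i\<in>Poly_Mapping.keys m. Poly_Mapping.lookup m i) = d)"

definition subst :: "(nat \<Rightarrow> 'k mpoly) \<Rightarrow> 'k::comm_ring_1 mpoly \<Rightarrow> 'k mpoly" where
  "subst s f = (\<Sum>m\<in>Poly_Mapping.keys f. const (Poly_Mapping.lookup f m) * (\<Prod>i\<in>Poly_Mapping.keys m. s i ^ Poly_Mapping.lookup m i))"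

text \<open>\<open>lin_comp t M f\<close> is \<open>f \<circ> M\<close>: the coordinate \<open>x\<^sub>i\<close> becomes the linear form
  \<open>v \<mapsto> (M v)\<^sub>i\<close>.\<close>

definition lin_comp :: "nat \<Rightarrow> 'k::comm_ring_1 mat \<Rightarrow> 'k mpoly \<Rightarrow> 'k mpoly" where
  "lin_comp t M = subst (\<lambda>i. \<Sum>j<t. const (M $$ (i, j)) * coord j)"


section \<open>Invariants and transfer of a matrix representation\<close>

abbreviation general_linear :: "'k::field itself \<Rightarrow> nat \<Rightarrow> 'k mat monoid" where
  "general_linear K t \<equiv> units_of (ring_mat K t ())"

definition poly_act ::
  "('g, 'b) monoid_scheme \<Rightarrow> ('g \<Rightarrow> 'k::field mat) \<Rightarrow> nat \<Rightarrow> 'g \<Rightarrow> 'k mpoly \<Rightarrow> 'k mpoly" where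
  "poly_act G \<rho> t g f = lin_comp t (\<rho> (inv\<^bsub>G\<^esub> g)) f"

definition invariants ::
  "('g, 'b) monoid_scheme \<Rightarrow> ('g \<Rightarrow> 'k::field mat) \<Rightarrow> nat \<Rightarrow> 'k mpoly set" where
  "invariants G \<rho> t = {f \<in> polys t. \<forall>g\<in>carrier G. poly_act G \<rho> t g f = f}"

definition invariant_ring ::
  "('g, 'b) monoid_scheme \<Rightarrow> ('g \<Rightarrow> 'k::field mat) \<Rightarrow> nat \<Rightarrow> 'k mpoly ring" where
  "invariant_ring G \<rho> t =
     \<lparr>carrier = invariants G \<rho> t, monoid.mult = (*), one = 1, zero = 0, add = (+)\<rparr>"

definition transfer ::
  "('g, 'b) monoid_scheme \<Rightarrow> ('g \<Rightarrow> 'k::field mat) \<Rightarrow> nat \<Rightarrow> 'k mpoly \<Rightarrow> 'k mpoly" where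
  "transfer G \<rho> t f = (\<Sum>g\<in>carrier G. poly_act G \<rho> t g f)"

definition transfer_quotient ::
  "('g, 'b) monoid_scheme \<Rightarrow> ('g \<Rightarrow> 'k::field mat) \<Rightarrow> nat \<Rightarrow> 'k mpoly set ring" where
  "transfer_quotient G \<rho> t = invariant_ring G \<rho> t Quot (transfer G \<rho> t ` polys t)"

definition transfer_quotient_grading ::
  "('g, 'b) monoid_scheme \<Rightarrow> ('g \<Rightarrow> 'k::field mat) \<Rightarrow> nat \<Rightarrow> nat \<Rightarrow> 'k mpoly set set" where
  "transfer_quotient_grading G \<rho> t d =
     (\<lambda>f. (transfer G \<rho> t ` polys t) +>\<^bsub>invariant_ring G \<rho> t\<^esub> f)
       ` {f \<in> invariants G \<rho> t. homogeneous d f}"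

definition fixed_vectors ::
  "('g, 'b) monoid_scheme \<Rightarrow> ('g \<Rightarrow> 'k::field mat) \<Rightarrow> nat \<Rightarrow> 'k vec set" where
  "fixed_vectors G \<rho> t = {v \<in> carrier_vec t. \<forall>g\<in>carrier G. \<rho> g *\<^sub>v v = v}"

definition fixed_dim ::
  "('g, 'b) monoid_scheme \<Rightarrow> ('g \<Rightarrow> 'k::field mat) \<Rightarrow> nat \<Rightarrow> nat" where
  "fixed_dim G \<rho> t =
     vectorspace.dim class_ring
       ((module_vec TYPE('k) t)\<lparr>carrier := fixed_vectors G \<rho> t\<rparr>)"

end

theory Submission
  imports Defs "HOL-Algebra.Multiplicative_Group"
begin

text \<open>Put \<open>N = 2\<^sup>r = 2M\<close>, \<open>D = \<sigma> - 1\<close> and \<open>t = M + f\<close>; faithfulness and parity of \<open>t\<close> give \<open>0 < f < M\<close> with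
  \<open>f\<close> odd, and \<open>V\<^sup>G\<close> is a line. In characteristic 2 the transfer is \<open>D\<^bsup>N-1\<^esup>\<close>. The norm \<open>\<nu>\<close> of the
  coordinate \<open>x\<^sub>0\<close> is monic of degree \<open>N\<close> in \<open>x\<^sub>0\<close>, so division by \<open>\<nu>\<close> commutes with the group and
  \<open>\<nu>\<close> is regular modulo transfers. Hence it suffices to find an invariant \<open>w\<close> outside
  \<open>(\<nu>) + Tr\<close> such that every invariant without constant term acts nilpotently on \<open>w\<close> modulo
  \<open>(\<nu>) + Tr\<close>.

  Take \<open>w = D\<^bsup>N-2\<^esup> h\<close> with \<open>D\<^bsup>N-1\<^esup> h = 0\<close>, so that \<open>w\<close> is a transfer from the subgroup
  \<open>H = \<langle>\<sigma>\<^sup>2\<rangle>\<close>. Then all transfers from \<open>H\<close> to \<open>G\<close> kill \<open>w\<close>, and these cut out the line \<open>V\<^sup>G\<close>, on which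
  \<open>\<nu>\<close> vanishes only at the origin; this is the nilpotency. It remains to choose \<open>h\<close> such that \<open>w\<close> is
  not a transfer, that is, such that \<open>h\<close> generates a summand of dimension \<open>N - 1\<close>.

  The functional \<open>\<theta>\<close>, the coefficient of \<open>x\<^sub>f \<cdots> x\<^bsub>M-1\<^esub>\<close>, kills the transfers from
  \<open>P = \<langle>\<sigma>\<^sup>M\<rangle>\<close> and is \<open>\<sigma>\<close>-invariant on \<open>P\<close>-invariants, so \<open>\<theta>(D\<^bsup>M-1\<^esup> h) = 1\<close> suffices. On \<open>V\<^sup>P\<close>, which is the regular
  representation of \<open>G/P\<close>, the iterated derivative \<open>\<partial>\<^sub>0 \<cdots> \<partial>\<^bsub>f-1\<^esub>\<close> of the norm of \<open>x\<^sub>0\<close> is invariant,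
  involves \<open>x\<^sub>0, \<dots>, x\<^bsub>f-1\<^esub>\<close> only through their squares, and contains \<open>x\<^sub>f \<cdots> x\<^bsub>M-1\<^esub>\<close>. Replacing
  \<open>x\<^sub>i\<^sup>2\<close> by the \<open>P\<close>-norm of \<open>x\<^sub>i\<close> yields a \<open>P\<close>-invariant \<open>v\<close> with \<open>\<theta>(v) = 1\<close> and \<open>D v = D\<^sup>M h\<close> for
  some \<open>h\<close>. Now \<open>v - D\<^bsup>M-1\<^esup> h\<close> is invariant, and \<open>\<theta>\<close> vanishes on invariants: already for the subgroup
  of order four the variables \<open>x\<^sub>f, \<dots>, x\<^bsub>M-1\<^esub>\<close> are the middle coordinates of an odd number of
  Jordan blocks of size three together with blocks of size two.\<close>

section \<open>Polynomials and evaluation homomorphisms\<close>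

lemma poly_mapping_sum_single:
  "f = (\<Sum>m\<in>Poly_Mapping.keys f. Poly_Mapping.single m (Poly_Mapping.lookup f m))"
proof (rule poly_mapping_eqI)
  fix k
  have "Poly_Mapping.lookup (\<Sum>m\<in>Poly_Mapping.keys f. Poly_Mapping.single m (Poly_Mapping.lookup f m)) k
     = (\<Sum>m\<in>Poly_Mapping.keys f. if m = k then Poly_Mapping.lookup f m else 0)"
    unfolding lookup_sum by (intro sum.cong) (auto simp: lookup_single when_def)
  also have "\<dots> = Poly_Mapping.lookup f k" by (simp add: in_keys_iff)
  finally show "Poly_Mapping.lookup f k = Poly_Mapping.lookup (\<Sum>m\<in>Poly_Mapping.keys f. Poly_Mapping.single m (Poly_Mapping.lookup f m)) k" by simp
qed

lemma coord_power: "(coord i :: 'k::comm_ring_1 mpoly) ^ n = Poly_Mapping.single (Poly_Mapping.single i n) 1"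
  by (induction n) (simp_all add: coord_def mult_single single_add[symmetric])

lemma prod_coord_power:
  assumes "finite A"
  shows "(\<Prod>i\<in>A. (coord i :: 'k::comm_ring_1 mpoly) ^ e i) = Poly_Mapping.single (\<Sum>i\<in>A. Poly_Mapping.single i (e i)) 1"
  using assms by (induction A rule: finite_induct) (simp_all add: coord_power mult_single)

lemma single_eq_const_prod:
  "(Poly_Mapping.single m c :: 'k::comm_ring_1 mpoly) = const c * (\<Prod>i\<in>Poly_Mapping.keys m. coord i ^ Poly_Mapping.lookup m i)"
  by (simp add: prod_coord_power const_def mult_single poly_mapping_sum_single[symmetric])

lemma const_hom: "comm_ring_hom (const :: 'k::comm_ring_1 \<Rightarrow> 'k mpoly)"
  by unfold_locales (simp_all add: const_def single_add mult_single)

lemma const_simps [simp]: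
  "const 0 = 0" "const 1 = 1" "const (a + b) = const a + const b" "const (a * b) = const a * const b"
  by (simp_all add: const_def single_add mult_single)

lemma mpoly_induct_coord [consumes 1, case_names const add mult]:
  fixes f :: "'k::comm_ring_1 mpoly"
  assumes f: "\<And>m. m \<in> Poly_Mapping.keys f \<Longrightarrow> Poly_Mapping.keys m \<subseteq> T"
    and c: "\<And>c. P (const c)"
    and a: "\<And>p q. P p \<Longrightarrow> P q \<Longrightarrow> P (p + q)"
    and m: "\<And>i p. i \<in> T \<Longrightarrow> P p \<Longrightarrow> P (coord i * p)"
  shows "P f"
proof -
  have pw: "P (coord i ^ n * p)" if "i \<in> T" "P p" for i n p
    using that by (induction n) (auto simp: mult.assoc intro: m)
  have pr: "P (const c * (\<Prod>i\<in>A. coord i ^ e i))" if "finite A" "A \<subseteq> T" for A c and e :: "nat \<Rightarrow> nat"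
    using that
  proof (induction A rule: finite_induct)
    case (insert x F)
    have "P (coord x ^ e x * (const c * (\<Prod>i\<in>F. coord i ^ e i)))"
      using insert by (intro pw) auto
    then show ?case using insert by (simp add: mult_ac)
  qed (simp add: c)
  have "P (\<Sum>m\<in>K. Poly_Mapping.single m (Poly_Mapping.lookup f m))" if "finite K" "K \<subseteq> Poly_Mapping.keys f" for K
    using that
  proof (induction K rule: finite_induct)
    case empty
    show ?case using c[of 0] by simp
  next
    case (insert x F)
    then show ?case using f[of x] by (auto simp: single_eq_const_prod intro!: a pr)
  qed
  then show ?thesis using poly_mapping_sum_single[of f] finite_keys by (metis subset_refl)
qed

lemma mpoly_induct [case_names const add mult]:
  fixes f :: "'k::comm_ring_1 mpoly"
  assumes "\<And>c. P (const c)" "\<And>p q. P p \<Longrightarrow> P q \<Longrightarrow> P (p + q)" "\<And>i p. P p \<Longrightarrow> P (coord i * p)"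
  shows "P f"
  by (rule mpoly_induct_coord[where T = UNIV]) (use assms in auto)

lemma mpoly_ring_induct [case_names const coord add mult]:
  fixes f :: "'k::comm_ring_1 mpoly"
  assumes "\<And>c. P (const c)" "\<And>i. P (coord i)" "\<And>p q. P p \<Longrightarrow> P q \<Longrightarrow> P (p + q)" "\<And>p q. P p \<Longrightarrow> P q \<Longrightarrow> P (p * q)"
  shows "P f"
  by (rule mpoly_induct) (use assms in auto)

lemma polys_induct [consumes 1, case_names const add mult]:
  assumes "f \<in> polys t"
    and "\<And>c. P (const c)" "\<And>p q. P p \<Longrightarrow> P q \<Longrightarrow> P (p + q)" "\<And>i p. i < t \<Longrightarrow> P p \<Longrightarrow> P (coord i * p)"
  shows "P f"
  by (rule mpoly_induct_coord[where T = "{..<t}" and f = f]) (use assms in \<open>auto simp: polys_def\<close>)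

text \<open>One evaluation, with the coefficients sent through \<open>\<phi>\<close>, yields
  \<open>subst\<close>, \<open>const_term\<close>, \<open>taylor\<close> and \<open>uni\<close>, so
  multiplicativity is proved once.\<close>

definition meval :: "('k::comm_ring_1 \<Rightarrow> 'b::comm_ring_1) \<Rightarrow> (nat \<Rightarrow> 'b) \<Rightarrow> 'k mpoly \<Rightarrow> 'b" where
  "meval \<phi> s f = (\<Sum>m\<in>Poly_Mapping.keys f. \<phi> (Poly_Mapping.lookup f m) * (\<Prod>i\<in>Poly_Mapping.keys m. s i ^ Poly_Mapping.lookup m i))"

lemma subst_eq_meval: "subst s = meval const s"
  by (rule ext) (simp add: subst_def meval_def)

context
  fixes \<phi> :: "'k::comm_ring_1 \<Rightarrow> 'b::comm_ring_1"
  assumes \<phi>: "comm_ring_hom \<phi>"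
begin

interpretation \<phi>: comm_ring_hom \<phi> by (rule \<phi>)

lemma meval_superset:
  assumes "finite A" "Poly_Mapping.keys f \<subseteq> A"
  shows "meval \<phi> s f = (\<Sum>m\<in>A. \<phi> (Poly_Mapping.lookup f m) * (\<Prod>i\<in>Poly_Mapping.keys m. s i ^ Poly_Mapping.lookup m i))"
  unfolding meval_def using assms
  by (intro sum.mono_neutral_left) (auto simp: in_keys_iff)

lemma meval_add: "meval \<phi> s (f + g) = meval \<phi> s f + meval \<phi> s g"
proof -
  let ?A = "Poly_Mapping.keys f \<union> Poly_Mapping.keys g"
  have "Poly_Mapping.keys (f + g) \<subseteq> ?A" by (rule keys_add)
  then show ?thesis
    by (subst (1 2 3) meval_superset[where A = ?A])
       (auto simp: lookup_add \<phi>.hom_add algebra_simps sum.distrib)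
qed

lemma meval_single:
  "meval \<phi> s (Poly_Mapping.single m c) = \<phi> c * (\<Prod>i\<in>Poly_Mapping.keys m. s i ^ Poly_Mapping.lookup m i)"
  by (subst meval_superset[where A = "{m}"]) auto

lemma monomial_value_superset:
  fixes m :: "nat \<Rightarrow>\<^sub>0 nat" and s :: "nat \<Rightarrow> 'b"
  assumes "finite A" "Poly_Mapping.keys m \<subseteq> A"
  shows "(\<Prod>i\<in>Poly_Mapping.keys m. s i ^ Poly_Mapping.lookup m i) = (\<Prod>i\<in>A. s i ^ Poly_Mapping.lookup m i)"
  using assms by (intro prod.mono_neutral_left) (auto simp: in_keys_iff)

lemma meval_mult_single:
  "meval \<phi> s (Poly_Mapping.single m a * Poly_Mapping.single n b)
     = meval \<phi> s (Poly_Mapping.single m a) * meval \<phi> s (Poly_Mapping.single n b)"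
proof -
  let ?A = "Poly_Mapping.keys m \<union> Poly_Mapping.keys n"
  have "Poly_Mapping.keys (m + n) \<subseteq> ?A" by (rule keys_add)
  then show ?thesis
    unfolding mult_single meval_single
    by (subst (1 2 3) monomial_value_superset[where A = ?A])
       (auto simp: lookup_add \<phi>.hom_mult power_add prod.distrib mult_ac)
qed

lemma meval_zero: "meval \<phi> s 0 = 0"
  by (simp add: meval_def)

lemma meval_sum: "meval \<phi> s (\<Sum>x\<in>A. h x) = (\<Sum>x\<in>A. meval \<phi> s (h x))"
  by (induction A rule: infinite_finite_induct) (simp_all add: meval_add meval_zero)

lemma meval_mult: "meval \<phi> s (f * g) = meval \<phi> s f * meval \<phi> s g"
proof -
  have "f * g = (\<Sum>m\<in>Poly_Mapping.keys f. \<Sum>n\<in>Poly_Mapping.keys g.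
      Poly_Mapping.single m (Poly_Mapping.lookup f m) * Poly_Mapping.single n (Poly_Mapping.lookup g n))"
    using sum_product[of "\<lambda>m. Poly_Mapping.single m (Poly_Mapping.lookup f m)" "Poly_Mapping.keys f"
        "\<lambda>n. Poly_Mapping.single n (Poly_Mapping.lookup g n)" "Poly_Mapping.keys g"]
    by (simp only: poly_mapping_sum_single[symmetric])
  then have "meval \<phi> s (f * g) = (\<Sum>m\<in>Poly_Mapping.keys f. \<Sum>n\<in>Poly_Mapping.keys g.
      meval \<phi> s (Poly_Mapping.single m (Poly_Mapping.lookup f m)) * meval \<phi> s (Poly_Mapping.single n (Poly_Mapping.lookup g n)))"
    by (simp only: meval_sum meval_mult_single)
  also have "\<dots> = meval \<phi> s f * meval \<phi> s g"
    unfolding meval_single by (simp only: meval_def sum_product)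
  finally show ?thesis .
qed

lemma meval_const [simp]: "meval \<phi> s (const c) = \<phi> c"
  by (simp add: const_def meval_single)

lemma meval_coord [simp]: "meval \<phi> s (coord i) = s i"
  by (simp add: coord_def meval_single)

lemma meval_hom: "comm_ring_hom (meval \<phi> s)"
proof
  show "meval \<phi> s 1 = 1" using meval_const[of s 1] by simp
qed (simp_all add: meval_add meval_mult meval_zero)

end

lemma mpoly_hom_eqI:
  fixes \<alpha> \<beta> :: "'k::comm_ring_1 mpoly \<Rightarrow> 'b::comm_ring_1"
  assumes "comm_ring_hom \<alpha>" "comm_ring_hom \<beta>"
    and "\<And>c. \<alpha> (const c) = \<beta> (const c)" "\<And>i. \<alpha> (coord i) = \<beta> (coord i)"
  shows "\<alpha> f = \<beta> f"
proof -
  interpret a: comm_ring_hom \<alpha> by fact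
  interpret b: comm_ring_hom \<beta> by fact
  show ?thesis by (induction f rule: mpoly_ring_induct) (auto simp: assms a.hom_add a.hom_mult b.hom_add b.hom_mult)
qed

lemma comm_ring_hom_comp:
  assumes "comm_ring_hom \<alpha>" "comm_ring_hom \<beta>"
  shows "comm_ring_hom (\<lambda>x. \<alpha> (\<beta> x))"
proof -
  interpret a: comm_ring_hom \<alpha> by fact
  interpret b: comm_ring_hom \<beta> by fact
  show ?thesis by unfold_locales (simp_all add: a.hom_add a.hom_mult b.hom_add b.hom_mult)
qed

lemma id_hom: "comm_ring_hom (\<lambda>x::'b::comm_ring_1. x)"
  by unfold_locales auto

lemma subst_hom: "comm_ring_hom (subst s)"
  unfolding subst_eq_meval by (rule meval_hom[OF const_hom])

lemma subst_const [simp]: "subst s (const c) = const c"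
  and subst_coord [simp]: "subst s (coord i) = s i"
  unfolding subst_eq_meval by (simp_all add: const_hom)

lemma subst_simps [simp]:
  "subst s 0 = 0" "subst s 1 = 1" "subst s (p + q) = subst s p + subst s q" "subst s (p - q) = subst s p - subst s q"
  "subst s (p * q) = subst s p * subst s q" "subst s (p ^ n) = subst s p ^ n" "subst s (- p) = - subst s p"
proof -
  interpret comm_ring_hom "subst s" by (rule subst_hom)
  show "subst s 0 = 0" "subst s 1 = 1" "subst s (p + q) = subst s p + subst s q" "subst s (p - q) = subst s p - subst s q"
  "subst s (p * q) = subst s p * subst s q" "subst s (p ^ n) = subst s p ^ n" "subst s (- p) = - subst s p"
    by (simp_all add: hom_distribs)
qed

lemma subst_sum: "subst s (\<Sum>x\<in>A. h x) = (\<Sum>x\<in>A. subst s (h x))"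
proof -
  interpret comm_ring_hom "subst s" by (rule subst_hom)
  show ?thesis by (rule hom_sum)
qed

lemma subst_prod: "subst s (\<Prod>x\<in>A. h x) = (\<Prod>x\<in>A. subst s (h x))"
proof -
  interpret comm_ring_hom "subst s" by (rule subst_hom)
  show ?thesis by (rule hom_prod)
qed

lemma subst_subst: "subst s (subst s' f) = subst (\<lambda>i. subst s (s' i)) f"
  by (rule mpoly_hom_eqI[OF comm_ring_hom_comp[OF subst_hom subst_hom] subst_hom]) auto

lemma subst_id [simp]: "subst coord f = f"
  by (rule mpoly_hom_eqI[OF subst_hom id_hom]) auto

lemma subst_cong_polys:
  assumes "f \<in> polys t" "\<And>i. i < t \<Longrightarrow> s i = s' i"
  shows "subst s f = subst s' f"
  using assms(1) by (induction f rule: polys_induct) (auto simp: assms(2))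

definition const_term :: "'k::comm_ring_1 mpoly \<Rightarrow> 'k" where
  "const_term f = Poly_Mapping.lookup f 0"

lemma const_term_eq_meval: "const_term = meval (\<lambda>x. x) (\<lambda>_. 0 :: 'k::comm_ring_1)"
proof
  fix f :: "'k mpoly"
  have *: "(\<Prod>i\<in>Poly_Mapping.keys m. (0::'k) ^ Poly_Mapping.lookup m i) = (if m = 0 then 1 else 0)" for m :: "nat \<Rightarrow>\<^sub>0 nat"
  proof (cases "m = 0")
    case False
    then obtain i where "i \<in> Poly_Mapping.keys m" by (metis equals0I keys_eq_empty)
    then show ?thesis using False by (auto simp: in_keys_iff power_0_left intro!: prod_zero bexI[of _ i])
  qed simp
  show "const_term f = meval (\<lambda>x. x) (\<lambda>_. 0) f"
    by (simp add: meval_def const_term_def * if_distrib in_keys_iff cong: if_cong)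
qed

lemma const_term_hom: "comm_ring_hom (const_term :: 'k::comm_ring_1 mpoly \<Rightarrow> 'k)"
  unfolding const_term_eq_meval by (rule meval_hom[OF id_hom])

lemma const_term_simps [simp]:
  fixes p q :: "'k::comm_ring_1 mpoly"
  shows "const_term (const c) = (c::'k)" "const_term (coord i :: 'k mpoly) = 0"
  "const_term (0 :: 'k mpoly) = 0" "const_term (1 :: 'k mpoly) = 1"
  "const_term (p + q) = const_term p + const_term q" "const_term (p * q) = const_term p * const_term q"
  "const_term (p ^ n) = const_term p ^ n"
proof -
  interpret comm_ring_hom "const_term :: 'k mpoly \<Rightarrow> 'k" by (rule const_term_hom)
  show "const_term (const c) = (c::'k)" "const_term (coord i :: 'k mpoly) = 0"
    by (simp_all add: const_term_eq_meval id_hom)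
  show "const_term (0 :: 'k mpoly) = 0" "const_term (1 :: 'k mpoly) = 1"
  "const_term (p + q) = const_term p + const_term q" "const_term (p * q) = const_term p * const_term q"
  "const_term (p ^ n) = const_term p ^ n"
    by (simp_all add: hom_distribs)
qed

lemma const_term_subst:
  assumes "\<And>i. const_term (s i) = 0"
  shows "const_term (subst s f) = const_term f"
  by (rule mpoly_hom_eqI[OF comm_ring_hom_comp[OF const_term_hom subst_hom] const_term_hom])
     (auto simp: assms)

lemma polys_const: "const c \<in> polys t"
  by (simp add: polys_def const_def)

lemma polys_coord: "i < t \<Longrightarrow> coord i \<in> polys t"
  by (simp add: polys_def coord_def)

lemma polys_add: "f \<in> polys t \<Longrightarrow> g \<in> polys t \<Longrightarrow> f + g \<in> polys t"
  using keys_add[of f g] by (fastforce simp: polys_def)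

lemma polys_mult:
  assumes "f \<in> polys t" "g \<in> polys t"
  shows "f * g \<in> polys t"
  unfolding polys_def
proof safe
  fix m x assume "m \<in> Poly_Mapping.keys (f * g)" "x \<in> Poly_Mapping.keys m"
  moreover obtain a b where "m = a + b" "a \<in> Poly_Mapping.keys f" "b \<in> Poly_Mapping.keys g"
    using keys_mult[of f g] calculation(1) by blast
  moreover have "Poly_Mapping.keys (a + b) \<subseteq> Poly_Mapping.keys a \<union> Poly_Mapping.keys b" by (rule keys_add)
  ultimately show "x < t" using assms unfolding polys_def by blast
qed

lemma polys_0 [simp]: "0 \<in> polys t" and polys_1 [simp]: "1 \<in> polys t"
  by (simp_all add: polys_def)

lemma polys_sum: "(\<And>x. x \<in> A \<Longrightarrow> h x \<in> polys t) \<Longrightarrow> (\<Sum>x\<in>A. h x) \<in> polys t"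
  by (induction A rule: infinite_finite_induct) (auto intro: polys_add)

lemma polys_prod: "(\<And>x. x \<in> A \<Longrightarrow> h x \<in> polys t) \<Longrightarrow> (\<Prod>x\<in>A. h x) \<in> polys t"
  by (induction A rule: infinite_finite_induct) (auto intro: polys_mult)

lemma polys_power: "f \<in> polys t \<Longrightarrow> f ^ n \<in> polys t"
  by (induction n) (auto intro: polys_mult)

lemma subst_in_polys:
  assumes "f \<in> polys t" "\<And>i. i < t \<Longrightarrow> s i \<in> polys t'"
  shows "subst s f \<in> polys t'"
  using assms(1) by (induction f rule: polys_induct) (auto intro: polys_add polys_mult polys_const assms(2))

section \<open>Partial derivatives\<close>

text \<open>Substitutes \<open>x_j + T\<close> for \<open>x_j\<close>, with \<open>T\<close> the
  outer variable. The linear coefficient in \<open>T\<close> is the derivative, which turns the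
  Leibniz rule into the product formula for coefficients.\<close>

definition taylor :: "nat \<Rightarrow> 'k::comm_ring_1 mpoly \<Rightarrow> 'k mpoly poly" where
  "taylor j = meval (\<lambda>c. [:const c:]) (\<lambda>i. if i = j then [:coord i, 1:] else [:coord i:])"

definition pd :: "nat \<Rightarrow> 'k::comm_ring_1 mpoly \<Rightarrow> 'k mpoly" where
  "pd j f = Polynomial.coeff (taylor j f) 1"

lemma const_poly_hom: "comm_ring_hom (\<lambda>c::'k::comm_ring_1. [:const c:])"
  by unfold_locales auto

lemma taylor_hom: "comm_ring_hom (taylor j :: 'k::comm_ring_1 mpoly \<Rightarrow> _)"
  unfolding taylor_def by (rule meval_hom[OF const_poly_hom])

lemma coeff_0_taylor: "Polynomial.coeff (taylor j f) 0 = f"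
proof -
  interpret comm_ring_hom "taylor j" by (rule taylor_hom)
  show ?thesis
    by (induction f rule: mpoly_ring_induct)
       (auto simp: hom_add hom_mult coeff_mult, auto simp: taylor_def const_poly_hom)
qed

lemma pd_const [simp]: "pd j (const c) = 0"
  by (simp add: pd_def taylor_def const_poly_hom)

lemma pd_coord: "pd j (coord i) = (if i = j then 1 else 0)"
  by (simp add: pd_def taylor_def const_poly_hom)

lemma pd_add [simp]: "pd j (f + g) = pd j f + pd j g"
proof -
  interpret comm_ring_hom "taylor j" by (rule taylor_hom)
  show ?thesis by (simp add: pd_def hom_add)
qed

lemma pd_mult: "pd j (f * g) = pd j f * g + f * pd j g"
proof -
  interpret comm_ring_hom "taylor j" by (rule taylor_hom)
  show ?thesis by (simp add: pd_def hom_mult coeff_mult coeff_0_taylor)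
qed

lemma pd_0 [simp]: "pd j 0 = 0" and pd_1 [simp]: "pd j 1 = 0"
  using pd_const[of j 0] pd_const[of j 1] by simp_all

lemma pd_commute: "pd i (pd j f) = pd j (pd i f)"
  by (induction f rule: mpoly_ring_induct) (auto simp: pd_coord pd_mult algebra_simps)

text \<open>Chain rule; \<open>L\<close> lists the variables whose image has derivative 1 in
  \<open>x_j\<close>, all others having derivative 0.\<close>

lemma pd_subst:
  assumes "\<And>i. pd j (s i) = (if i \<in> L then 1 else 0)" "finite L"
  shows "pd j (subst s f) = (\<Sum>l\<in>L. subst s (pd l f))"
proof (induction f rule: mpoly_ring_induct)
  case (coord i)
  have "(\<Sum>l\<in>L. subst s (pd l (coord i))) = (\<Sum>l\<in>L. if l = i then 1 else 0)"
    by (intro sum.cong) (auto simp: pd_coord)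
  then show ?case by (simp add: assms)
next
  case (mult p q)
  then show ?case
    by (simp add: pd_mult sum.distrib sum_distrib_left sum_distrib_right)
qed (auto simp: sum.distrib)


section \<open>The shift automorphism in characteristic two\<close>

text \<open>For \<open>d = 1\<close> this is composition with the Jordan block; in characteristic
  two \<open>d = 2^n\<close> gives its \<open>2^n\<close>-th power. Variables from index
  \<open>t\<close> on are fixed, which spares a restriction to \<open>polys t\<close>.\<close>

definition shift :: "nat \<Rightarrow> nat \<Rightarrow> 'k::comm_ring_1 mpoly \<Rightarrow> 'k mpoly" where
  "shift t d = subst (\<lambda>i. coord i + (if i + d < t then coord (i + d) else 0))"

lemma shift_hom: "comm_ring_hom (shift t d)"
  unfolding shift_def by (rule subst_hom)

lemma shift_simps [simp]:
  "shift t d 0 = 0" "shift t d 1 = 1" "shift t d (p + q) = shift t d p + shift t d q"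
  "shift t d (p * q) = shift t d p * shift t d q" "shift t d (p ^ n) = shift t d p ^ n"
  "shift t d (const c) = const c"
  by (simp_all add: shift_def)

lemma shift_coord: "shift t d (coord i) = coord i + (if i + d < t then coord (i + d) else 0)"
  by (simp add: shift_def)

lemma const_term_shift [simp]: "const_term (shift t d p) = const_term p"
  unfolding shift_def by (rule const_term_subst) simp

lemma pd_shift:
  assumes "d > 0"
  shows "pd j (shift t d p) = shift t d (pd j p + (if d \<le> j \<and> j < t then pd (j - d) p else 0))"
proof -
  let ?L = "insert j (if d \<le> j \<and> j < t then {j - d} else {})"
  have "pd j (shift t d p) = (\<Sum>l\<in>?L. shift t d (pd l p))"
    unfolding shift_def by (rule pd_subst) (use assms in \<open>auto simp: pd_coord\<close>)
  also have "\<dots> = shift t d (pd j p + (if d \<le> j \<and> j < t then pd (j - d) p else 0))"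
    using assms by auto
  finally show ?thesis .
qed

section \<open>Iterated derivatives and the rules of characteristic two\<close>

primrec pds :: "nat list \<Rightarrow> 'k::comm_ring_1 mpoly \<Rightarrow> 'k mpoly" where
  "pds [] p = p"
| "pds (j # js) p = pd j (pds js p)"

lemma pds_append: "pds (xs @ ys) p = pds xs (pds ys p)"
  by (induction xs) auto

lemma pds_pd: "pds xs (pd j p) = pd j (pds xs p)"
  by (induction xs) (auto simp: pd_commute)

lemma pds_pds: "pds xs (pds ys p) = pds ys (pds xs p)"
  by (induction xs) (auto simp: pds_pd)

lemma pds_add [simp]: "pds xs (p + q) = pds xs p + pds xs q"
  by (induction xs) auto

lemma pds_0 [simp]: "pds xs 0 = 0"
  by (induction xs) auto

locale char_two =
  fixes K :: "'k::field itself"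
  assumes char_two: "CHAR('k) = 2"
begin

lemma add_self_field: "(a :: 'k) + a = 0"
proof -
  have "(of_nat CHAR('k) :: 'k) = 0" by (rule of_nat_CHAR)
  then have "(1 :: 'k) + 1 = 0" by (simp add: char_two)
  then show ?thesis by (metis distrib_left mult.right_neutral mult_zero_right)
qed

lemma add_self [simp]: "(p :: 'k mpoly) + p = 0"
proof -
  have "p + p = const (1 + 1) * p" by (simp only: const_simps distrib_right mult_1_left)
  then show ?thesis by (simp only: add_self_field const_simps mult_zero_left)
qed

lemma two_eq_0 [simp]: "(2 :: 'k mpoly) = 0"
  using add_self[of 1] by (simp del: add_self)

lemma add_self_left [simp]: "(p :: 'k mpoly) + (p + q) = q"
  by (simp add: add.assoc[symmetric])

lemma uminus_eq [simp]: "- (p :: 'k mpoly) = p"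
  by (simp add: minus_unique)

lemma diff_eq [simp]: "(p :: 'k mpoly) - q = p + q"
  using diff_conv_add_uminus[of p q] by simp

lemma add_eq_0_iff': "(p :: 'k mpoly) + q = 0 \<longleftrightarrow> p = q"
  by (metis add_self add_self_left add.right_neutral)

lemma add_eq_iff: "(p :: 'k mpoly) + q = r \<longleftrightarrow> p = q + r"
  by (metis add_self_left add.commute)

lemma square_add: "((p :: 'k mpoly) + q) ^ 2 = p ^ 2 + q ^ 2"
proof -
  have "(p + q) ^ 2 = p ^ 2 + q ^ 2 + (p * q + p * q)" by (simp only: power2_eq_square distrib_left distrib_right add_ac mult_ac)
  then show ?thesis by simp
qed

lemma power_two_power_add: "((p :: 'k mpoly) + q) ^ (2 ^ n) = p ^ (2 ^ n) + q ^ (2 ^ n)"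
  by (induction n) (simp_all add: power_mult square_add mult.commute[of 2])

lemma pd_pd [simp]: "pd j (pd j (p :: 'k mpoly)) = 0"
proof (induction p rule: mpoly_ring_induct)
  case (mult p q)
  have "pd j (pd j (p * q)) = pd j p * pd j q + pd j p * pd j q"
    using mult by (simp add: pd_mult del: add_self)
  then show ?case by simp
qed (auto simp: pd_coord)

text \<open>A repeated index produces a second derivative, which is zero in characteristic two.
  Unwanted terms of shifted derivatives disappear for this reason.\<close>

lemma pds_member_pd:
  assumes "j \<in> set js"
  shows "pds js (pd j (p :: 'k mpoly)) = 0"
  using assms by (induction js) (auto simp: pds_pd pd_commute[of j])

text \<open>The two copies of \<open>x_(i+d)\<close> cancel.\<close>

lemma shift_shift: "shift t d (shift t d (p :: 'k mpoly)) = shift t (2 * d) p"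
  unfolding shift_def subst_subst
  by (rule arg_cong[where f = "\<lambda>s. subst s p"]) (auto simp: fun_eq_iff add_ac mult_2)

lemma shift_power: "(shift t d ^^ 2 ^ n) (p :: 'k mpoly) = shift t (2 ^ n * d) p"
proof (induction n arbitrary: p)
  case (Suc n)
  have "(shift t d ^^ 2 ^ Suc n) p = (shift t d ^^ 2 ^ n) ((shift t d ^^ 2 ^ n) p)"
    by (simp add: mult_2 funpow_add)
  also have "\<dots> = shift t (2 ^ n * d) (shift t (2 ^ n * d) p)"
    unfolding Suc ..
  finally show ?case by (simp add: shift_shift mult_ac)
qed simp

lemma shift_large: "t \<le> d \<Longrightarrow> shift t d p = (p :: 'k mpoly)"
  by (simp add: shift_def)

end

text \<open>Here \<open>t = M + f\<close> with \<open>M = 2m = 2\<^bsup>e+1\<^esup>\<close>, so that \<open>sg\<close> has order \<open>2M\<close>.\<close>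

locale jordan_char_two = char_two K for K :: "'k::field itself" +
  fixes e f :: nat
  assumes f_odd: "odd f" and f_less: "f < 2 ^ Suc e"
begin

text \<open>\<open>sg ^^ m\<close> generates the subgroup of order four and \<open>sg ^^ M\<close>
  the subgroup \<open>P\<close> of order two.\<close>

definition m :: nat where "m = 2 ^ e"
definition M :: nat where "M = 2 * m"
definition t :: nat where "t = M + f"

lemma m_pos: "0 < m" by (simp add: m_def)
lemma M_eq: "M = 2 ^ Suc e" by (simp add: M_def m_def)
lemma f_pos: "0 < f" using f_odd by (rule odd_pos)
lemma f_less_M: "f < M" using f_less by (simp add: M_eq)

definition sg :: "'k mpoly \<Rightarrow> 'k mpoly" where "sg = shift t 1"

definition D :: "'k mpoly \<Rightarrow> 'k mpoly" where "D p = sg p + p"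

lemma sg_simps [simp]:
  "sg 0 = 0" "sg 1 = 1" "sg (p + q) = sg p + sg q" "sg (p * q) = sg p * sg q" "sg (p ^ n) = sg p ^ n"
  "sg (const c) = const c" "const_term (sg p) = const_term p"
  by (simp_all add: sg_def)

lemma sg_coord: "sg (coord i) = coord i + (if Suc i < t then coord (Suc i) else 0)"
  by (simp add: sg_def shift_coord)

lemma sg_power: "(sg ^^ 2 ^ n) p = shift t (2 ^ n) p"
  by (simp add: sg_def shift_power)

lemma sg_funpow_simps [simp]:
  "(sg ^^ n) 0 = 0" "(sg ^^ n) 1 = 1" "(sg ^^ n) (p + q) = (sg ^^ n) p + (sg ^^ n) q"
  "(sg ^^ n) (p * q) = (sg ^^ n) p * (sg ^^ n) q"
  "const_term ((sg ^^ n) p) = const_term p"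
  by (induction n) auto

lemma D_add [simp]: "D (p + q) = D p + D q" and D_0 [simp]: "D 0 = 0"
  by (simp_all add: D_def add_ac)

lemma D_funpow_add [simp]: "(D ^^ n) (p + q) = (D ^^ n) p + (D ^^ n) q"
  by (induction n) auto

lemma D_funpow_0 [simp]: "(D ^^ n) 0 = 0"
  by (induction n) auto

text \<open>\<open>D\<close> is \<open>sg + 1\<close> in a commutative ring of operators of
  characteristic two, so squaring it produces no mixed term.\<close>

lemma D_power: "(D ^^ 2 ^ n) p = (sg ^^ 2 ^ n) p + p"
proof (induction n arbitrary: p)
  case (Suc n)
  have "(D ^^ 2 ^ Suc n) p = (D ^^ 2 ^ n) ((D ^^ 2 ^ n) p)"
    by (simp add: mult_2 funpow_add)
  also have "\<dots> = (sg ^^ 2 ^ Suc n) p + p"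
    unfolding Suc by (simp add: mult_2 funpow_add add_ac)
  finally show ?case .
qed (simp add: D_def)

lemma D_power': "(D ^^ 2 ^ n) p = shift t (2 ^ n) p + p"
  by (simp only: D_power sg_power)

definition tau :: "'k mpoly \<Rightarrow> 'k mpoly" where "tau = shift t M"
definition qa :: "'k mpoly \<Rightarrow> 'k mpoly" where "qa = shift t m"

lemma D_M: "(D ^^ M) p = tau p + p"
  unfolding M_eq tau_def D_power' ..

lemma sg_M: "(sg ^^ M) p = tau p"
  unfolding M_eq tau_def sg_power ..

lemma sg_m: "(sg ^^ m) p = qa p"
  unfolding m_def qa_def sg_power ..

lemma tau_simps [simp]:
  "tau 0 = 0" "tau 1 = 1" "tau (p + q) = tau p + tau q" "tau (p * q) = tau p * tau q" "tau (p ^ n) = tau p ^ n"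
  "tau (const c) = const c" "const_term (tau p) = const_term p"
  by (simp_all add: tau_def)

lemma tau_coord: "tau (coord i) = coord i + (if i < f then coord (i + M) else 0)"
  by (auto simp: tau_def shift_coord t_def)

lemma tau_tau [simp]: "tau (tau p) = p"
  by (simp add: tau_def shift_shift shift_large t_def f_less_M[THEN less_imp_le] mult_2)

lemma qa_simps [simp]:
  "qa 0 = 0" "qa (p + q) = qa p + qa q" "const_term (qa p) = const_term p"
  by (simp_all add: qa_def)

lemma qa_qa: "qa (qa p) = tau p"
  by (simp add: qa_def tau_def shift_shift M_def)

lemma sg_tau: "sg (tau p) = tau (sg p)"
  by (simp flip: sg_M add: funpow_swap1)

lemma pd_sg: "pd j (sg p) = sg (pd j p + (if 0 < j \<and> j < t then pd (j - 1) p else 0))"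
  unfolding sg_def by (subst pd_shift) (auto simp: Suc_le_eq)

lemma pd_tau_low: "j < M \<Longrightarrow> pd j (tau p) = tau (pd j p)"
  unfolding tau_def by (subst pd_shift) (use m_pos M_def in auto)

lemma pd_tau_high: "i < f \<Longrightarrow> pd (i + M) (tau p) = tau (pd (i + M) p + pd i p)"
  unfolding tau_def by (subst pd_shift) (use m_pos M_def t_def in auto)

lemma pd_qa_low: "j < m \<Longrightarrow> pd j (qa p) = qa (pd j p)"
  unfolding qa_def by (subst pd_shift) (use m_pos in auto)

lemma pd_qa_high: "i + m < t \<Longrightarrow> pd (i + m) (qa p) = qa (pd (i + m) p + pd i p)"
  unfolding qa_def by (subst pd_shift) (use m_pos in auto)

lemma pds_tau: "(\<forall>j\<in>set js. j < M) \<Longrightarrow> pds js (tau p) = tau (pds js p)"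
  by (induction js) (auto simp: pd_tau_low)

text \<open>Differentiating once in each of the distinct variables and evaluating at the origin
  reads off the coefficient of the squarefree monomial \<open>x_f ... x_(M-1)\<close>.\<close>

definition theta :: "'k mpoly \<Rightarrow> 'k" where
  "theta p = const_term (pds [f..<M] p)"

lemma theta_add [simp]: "theta (p + q) = theta p + theta q" and theta_0 [simp]: "theta 0 = 0"
  by (simp_all add: theta_def)

lemma theta_tau: "theta (tau p) = theta p"
  by (simp add: theta_def pds_tau)

text \<open>Compare the coefficients of \<open>x_(i+M)\<close> in \<open>p\<close> and
  \<open>tau p\<close>; the latter also receives that of \<open>x_i\<close>.\<close>

lemma const_term_pd_tau_fixed:
  assumes "tau p = p" "i < f"
  shows "const_term (pd i p) = 0"
proof -
  have "const_term (pd (i + M) p) = const_term (pd (i + M) (tau p))" using assms by simp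
  also have "\<dots> = const_term (pd (i + M) p) + const_term (pd i p)"
    using assms(2) by (simp add: pd_tau_high)
  finally show ?thesis by simp
qed

text \<open>Differentiating \<open>sg p\<close> in \<open>x_n\<close> adds the derivative in
  \<open>x_(n-1)\<close>. The extra term repeats an index still to come, except at the lower end
  \<open>n = f\<close>, where \<open>tau\<close>-invariance removes the coefficient of
  \<open>x_(f-1)\<close>.\<close>

lemma theta_sg:
  assumes "tau p = p"
  shows "theta (sg p) = theta p"
proof -
  \<comment> \<open>The upper end is generalized because derivatives are peeled off from the top;
    those below \<open>M\<close> commute with \<open>tau\<close>, so invariance passes to the
    induction.\<close>
  have "const_term (pds [f..<n] (sg p)) = const_term (pds [f..<n] p)" if "f \<le> n" "n \<le> M" "tau p = p" for n p
    using that
  proof (induction n arbitrary: p rule: dec_induct)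
    case base
    then show ?case by simp
  next
    case (step n)
    let ?p = "pd n p + pd (n - 1) p"
    have "0 < n" "n < M" "n < t" using step f_pos f_less_M t_def by auto
    have tp: "tau ?p = ?p"
      using step.prems \<open>n < M\<close> pd_tau_low[of n p] pd_tau_low[of "n - 1" p] by simp
    have split: "pds [f..<Suc n] x = pds [f..<n] (pd n x)" for x :: "'k mpoly"
      using step.hyps by (simp add: pds_append)
    have z: "const_term (pds [f..<n] (pd (n - 1) p)) = 0"
    proof (cases "n = f")
      case True
      then show ?thesis using const_term_pd_tau_fixed[OF step.prems(2), of "f - 1"] f_pos by simp
    next
      case False
      then have "n - 1 \<in> set [f..<n]" using step.hyps by auto
      then show ?thesis by (simp add: pds_member_pd)
    qed
    have "const_term (pds [f..<Suc n] (sg p)) = const_term (pds [f..<n] (sg ?p))"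
      using \<open>0 < n\<close> \<open>n < t\<close> by (simp only: split pd_sg simp_thms if_True)
    also have "\<dots> = const_term (pds [f..<n] ?p)"
      using step.IH[of ?p] \<open>n < M\<close> tp by simp
    also have "\<dots> = const_term (pds [f..<Suc n] p)"
      by (simp only: split pds_add const_term_simps z add_0_right)
    finally show ?case .
  qed
  then show ?thesis using assms f_less_M by (simp add: theta_def)
qed

section \<open>Parity\<close>

text \<open>\<open>i\<close>, \<open>i + m\<close> and \<open>i + M\<close> lie in one Jordan block
  of \<open>qa\<close>. One index is settled by comparing coefficients of \<open>x_(i+M)\<close>;
  two indices are traded for the operator \<open>\<beta>\<close>, which commutes with
  \<open>qa\<close> and keeps the length of the list odd.\<close>

lemma qa_fixed_triples:
  assumes "qa p = p" "odd (length L)" "\<forall>i\<in>set L. i < m \<and> i + M < t"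
  shows "const_term (pds (map (\<lambda>i. i + m) L) p) = 0"
  using assms
proof (induction "length L" arbitrary: L p rule: less_induct)
  case less
  have M2: "i + M = (i + m) + m" for i by (simp add: M_def)
  show ?case
  proof (cases L)
    case Nil
    then show ?thesis using less by simp
  next
    case (Cons i L1)
    note L = this
    show ?thesis
    proof (cases L1)
      case Nil
      have "const_term (pd (i + M) p) = const_term (pd (i + M) (qa p))" using less.prems by simp
      also have "\<dots> = const_term (pd (i + M) p) + const_term (pd (i + m) p)"
        using less.prems(3) L unfolding M2 by (subst pd_qa_high) (auto simp: M2)
      finally show ?thesis using L Nil by simp
    next
      case (Cons i' L2)
      have i: "i < m" "i' < m" "i + M < t" "i' + M < t" "i < M" "i' < M" "i + m < M" "i' + m < M" "i + m < t" "i' + m < t" "i < f" "i' < f"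
        using less.prems(3) L Cons by (auto simp: M_def t_def)
      note low = pd_qa_low[OF i(1)] pd_qa_low[OF i(2)] pd_qa_high[OF i(9)] pd_qa_high[OF i(10)]
        pd_qa_high[of "i + m", folded M2, OF i(3)] pd_qa_high[of "i' + m", folded M2, OF i(4)]
      text \<open>\<open>\<beta>\<close> is the invariant symmetric form on the pair of size three Jordan blocks indexed by \<open>i, i'\<close>.\<close>
      define \<beta> where "\<beta> p = pd (i + m) (pd (i' + m) p) + pd i (pd (i' + M) p) + pd (i + M) (pd i' p) + pd i (pd (i' + m) p)" for p :: "'k mpoly"
      define b where "b = pds (map (\<lambda>i. i + m) L2) p"
      have "qa (\<beta> p) = \<beta> (qa p)"
        unfolding \<beta>_def by (simp add: low)
      then have "qa (\<beta> p) = \<beta> p" using less.prems(1) by simp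
      then have 1: "const_term (pds (map (\<lambda>i. i + m) L2) (\<beta> p)) = 0"
        using less.prems L Cons by (intro less.hyps) auto
      have 2: "pds (map (\<lambda>i. i + m) L2) (\<beta> p) = \<beta> b"
        by (simp add: \<beta>_def b_def pds_pd)
      have tp: "tau p = p" using less.prems(1) by (metis qa_qa)
      have tb: "tau b = b"
        unfolding b_def by (subst pds_tau[symmetric]) (use less.prems(3) L Cons tp in \<open>auto simp: M_def\<close>)
      note tauh = pd_tau_high[OF i(11)] pd_tau_high[OF i(12)]
      \<comment> \<open>The remaining terms of \<open>\<beta>\<close> contribute nothing, by
        invariance under \<open>tau\<close> alone.\<close>
      have "const_term (pd (i + M) (pd (i' + M) b)) = const_term (pd (i + M) (pd (i' + M) (tau b)))" using tb by simp
      then have 3: "const_term (pd i (pd (i' + M) b)) + const_term (pd (i + M) (pd i' b)) + const_term (pd i (pd i' b)) = 0"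
        by (simp add: tauh add.assoc)
      have "const_term (pd (i + M) (pd i' b)) = const_term (pd (i + M) (pd i' (tau b)))" using tb by simp
      then have 4: "const_term (pd i (pd i' b)) = 0"
        using i by (simp add: tauh pd_tau_low)
      have "const_term (pd (i + M) (pd (i' + m) b)) = const_term (pd (i + M) (pd (i' + m) (tau b)))" using tb by simp
      then have 5: "const_term (pd i (pd (i' + m) b)) = 0"
        using i by (simp add: tauh pd_tau_low)
      have "const_term (pd (i + m) (pd (i' + m) b)) = 0"
        using 1[unfolded 2] 3 4 5 by (simp add: \<beta>_def add.assoc)
      then show ?thesis by (simp add: L Cons b_def)
    qed
  qed
qed

text \<open>The extra term of \<open>pd i (pd (i + m) (qa b))\<close> repeats \<open>x_i\<close>, so
  complete pairs can be split off without losing invariance.\<close>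

lemma pairs_qa:
  assumes "\<forall>i\<in>set A. i < m" "qa p = p"
  shows "qa (pds A (pds (map (\<lambda>i. i + m) A) p)) = pds A (pds (map (\<lambda>i. i + m) A) p)"
  using assms(1)
proof (induction A)
  case (Cons i A)
  let ?b = "pds A (pds (map (\<lambda>i. i + m) A) p)"
  have b: "qa ?b = ?b" using Cons by simp
  have eq: "pds (i # A) (pds (map (\<lambda>i. i + m) (i # A)) p) = pd i (pd (i + m) ?b)"
    by (simp add: pds_pd pd_commute[of i])
  have "i < m" "i + m < t" using Cons.prems f_pos by (auto simp: t_def M_def)
  then have "qa (pd i (pd (i + m) ?b)) = pd i (pd (i + m) (qa ?b))"
    by (simp add: pd_qa_low pd_qa_high)
  then show ?case unfolding eq by (simp add: b)
qed (simp add: assms)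

lemma map_add_upt': "map (\<lambda>i. i + n) [a..<b] = [a + n..<b + n]"
  by (induction b) auto

text \<open>For \<open>m \<le> f\<close> the variables of \<open>theta\<close> are the middle
  coordinates of \<open>M - f\<close> triples, an odd number. For \<open>f < m\<close> they are
  \<open>f\<close> such middle coordinates, again an odd number, together with \<open>m - f\<close>
  complete pairs.\<close>

lemma theta_qa_fixed:
  assumes "qa p = p"
  shows "theta p = 0"
proof (cases "m \<le> f")
  case True
  then have "[f..<M] = map (\<lambda>i. i + m) [f - m..<m]"
    by (simp add: map_add_upt' M_def mult_2)
  then show ?thesis
    unfolding theta_def
    using qa_fixed_triples[OF assms, of "[f - m..<m]"] True f_odd f_less_M
    by (auto simp: t_def M_def)
next
  case False
  have "[f..<M] = [f..<m] @ [m..<m + f] @ [m + f..<M]"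
    using upt_add_eq_append[of f m "m - f + (m - f) + f - (m - f)"] upt_add_eq_append[of m "m + f" "m - f"] upt_add_eq_append[of f m m] False
    by (simp add: M_def mult_2)
  moreover have "[m..<m + f] = map (\<lambda>i. i + m) [0..<f]" "[m + f..<M] = map (\<lambda>i. i + m) [f..<m]"
    by (simp_all add: map_add_upt' add.commute M_def mult_2)
  ultimately have "pds [f..<M] p = pds (map (\<lambda>i. i + m) [0..<f]) (pds [f..<m] (pds (map (\<lambda>i. i + m) [f..<m]) p))"
    by (simp only: pds_append) (rule pds_pds)
  then show ?thesis
    unfolding theta_def
    using qa_fixed_triples[OF pairs_qa[of "[f..<m]", OF _ assms], of "[0..<f]"] False f_odd
    by (auto simp: t_def M_def)
qed

end


section \<open>Polynomials as univariate polynomials\<close>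

text \<open>Univariate in \<open>x_j\<close>, with coefficients free of \<open>x_j\<close> but still
  stored in the full ring.\<close>

definition uni :: "nat \<Rightarrow> 'k::comm_ring_1 mpoly \<Rightarrow> 'k mpoly poly" where
  "uni j = meval (\<lambda>c. [:const c:]) (\<lambda>i. if i = j then [:0, 1:] else [:coord i:])"

lemma uni_hom: "comm_ring_hom (uni j :: 'k::comm_ring_1 mpoly \<Rightarrow> _)"
  unfolding uni_def by (rule meval_hom[OF const_poly_hom])

lemma uni_const [simp]: "uni j (const c) = [:const c:]"
  and uni_coord: "uni j (coord i) = (if i = j then [:0, 1:] else [:coord i:])"
  by (simp_all add: uni_def const_poly_hom)

lemma uni_simps [simp]:
  "uni j 0 = 0" "uni j 1 = 1" "uni j (p + q) = uni j p + uni j q" "uni j (p * q) = uni j p * uni j q"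
  "uni j (p - q) = uni j p - uni j q"
proof -
  interpret comm_ring_hom "uni j" by (rule uni_hom)
  show "uni j 0 = 0" "uni j 1 = 1" "uni j (p + q) = uni j p + uni j q" "uni j (p * q) = uni j p * uni j q"
    "uni j (p - q) = uni j p - uni j q"
    by (simp_all add: hom_distribs)
qed

lemma poly_uni: "poly (uni j f) (coord j) = f"
  by (induction f rule: mpoly_ring_induct) (auto simp: uni_coord)

lemma uni_eq_0_iff [simp]: "uni j f = 0 \<longleftrightarrow> f = 0"
  using poly_uni[of j f] by auto

section \<open>Squaring variables\<close>

definition square_var :: "nat \<Rightarrow> 'k::comm_ring_1 mpoly \<Rightarrow> 'k mpoly" where
  "square_var n = subst (\<lambda>i. if i = n then coord i ^ 2 else coord i)"

definition square_vars :: "nat \<Rightarrow> 'k::comm_ring_1 mpoly \<Rightarrow> 'k mpoly" where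
  "square_vars n = subst (\<lambda>i. if i < n then coord i ^ 2 else coord i)"

lemma square_vars_0 [simp]: "square_vars 0 p = p"
  by (simp add: square_vars_def)

lemma square_vars_Suc: "square_vars (Suc n) p = square_vars n (square_var n p)"
  unfolding square_vars_def square_var_def subst_subst
  by (rule arg_cong[where f = "\<lambda>s. subst s p"]) auto

lemma square_var_inj:
  assumes "square_var n (p :: 'k::idom mpoly) = 0"
  shows "p = 0"
proof -
  have h: "comm_ring_hom (\<lambda>q. pcompose q [:0, 0, 1 :: 'k mpoly:])"
    by unfold_locales (simp_all add: pcompose_add pcompose_mult pcompose_1)
  have "uni n (square_var n p) = pcompose (uni n p) [:0, 0, 1:]"
    unfolding square_var_def
    by (rule mpoly_hom_eqI[OF comm_ring_hom_comp[OF uni_hom subst_hom] comm_ring_hom_comp[OF h uni_hom]])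
       (auto simp: uni_coord power2_eq_square pcompose_pCons)
  then have "pcompose (uni n p) [:0, 0, 1:] = 0" using assms by simp
  then have "uni n p = 0" by (subst (asm) pcompose_eq_0_iff) auto
  then show ?thesis by simp
qed

lemma square_vars_inj: "square_vars n (p :: 'k::idom mpoly) = 0 \<Longrightarrow> p = 0"
  by (induction n arbitrary: p) (auto simp: square_vars_Suc dest: square_var_inj)

lemma square_var_decomp: "\<exists>a b. p = square_var n a + coord n * square_var n (b :: 'k::comm_ring_1 mpoly)"
proof (induction p rule: mpoly_induct)
  case (const c)
  show ?case by (rule exI[of _ "const c"], rule exI[of _ 0]) (simp add: square_var_def)
next
  case (add p q)
  then obtain a b a' b' where "p = square_var n a + coord n * square_var n b" "q = square_var n a' + coord n * square_var n b'"
    by blast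
  then show ?case
    by (intro exI[of _ "a + a'"] exI[of _ "b + b'"]) (simp add: square_var_def algebra_simps)
next
  case (mult i p)
  then obtain a b where p: "p = square_var n a + coord n * square_var n b" by blast
  show ?case
  proof (cases "i = n")
    case True
    then show ?thesis
      by (intro exI[of _ "coord n * b"] exI[of _ "a"]) (simp add: p square_var_def algebra_simps power2_eq_square)
  next
    case False
    then show ?thesis
      by (intro exI[of _ "coord i * a"] exI[of _ "coord i * b"]) (simp add: p square_var_def algebra_simps)
  qed
qed

context char_two
begin

lemma pd_square: "pd j ((p :: 'k mpoly) ^ 2) = 0"
  by (simp add: power2_eq_square pd_mult mult.commute)

lemma pd_square_var: "pd n (square_var n (p :: 'k mpoly)) = 0"
  unfolding square_var_def by (subst pd_subst[where L = "{}"]) (auto simp: pd_square pd_coord)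

lemma pd_square_vars: "n \<le> j \<Longrightarrow> pd j (square_vars n (p :: 'k mpoly)) = square_vars n (pd j p)"
  unfolding square_vars_def by (subst pd_subst[where L = "{j}"]) (auto simp: pd_square pd_coord)

text \<open>By \<open>square_var_decomp\<close> the derivative in \<open>x_n\<close> is the odd part
  divided by \<open>x_n\<close>, so its vanishing leaves even powers only; variables are treated one
  after another.\<close>

lemma square_vars_exists:
  assumes "\<forall>j<n. pd j (p :: 'k mpoly) = 0"
  shows "\<exists>p0. p = square_vars n p0"
  using assms
proof (induction n)
  case (Suc n)
  then obtain p1 where p1: "p = square_vars n p1" by auto
  then have "square_vars n (pd n p1) = 0" using Suc.prems pd_square_vars[of n n p1] by simp
  then have "pd n p1 = 0" by (rule square_vars_inj)
  moreover obtain a b where "p1 = square_var n a + coord n * square_var n b"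
    using square_var_decomp by blast
  ultimately have "p1 = square_var n a"
    by (simp add: pd_mult pd_square_var pd_coord)
  then show ?case using p1 square_vars_Suc by metis
qed simp

end

lemma pd_prod_zero:
  "(\<And>x. x \<in> A \<Longrightarrow> pd j (h x) = 0) \<Longrightarrow> pd j (\<Prod>x\<in>A. h x) = 0"
  by (induction A rule: infinite_finite_induct) (auto simp: pd_mult)

lemma prod_cyclic_shift:
  fixes g :: "nat \<Rightarrow> 'b::comm_monoid_mult"
  assumes "g n = g 0" "n > 0"
  shows "(\<Prod>i<n. g (Suc i)) = (\<Prod>i<n. g i)"
proof -
  obtain k where n: "n = Suc k" using assms gr0_implies_Suc by blast
  have "(\<Prod>i<Suc k. g i) = g 0 * (\<Prod>i<k. g (Suc i))" by (rule prod.lessThan_Suc_shift)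
  then show ?thesis using assms(1) by (simp add: n mult.commute)
qed

section \<open>The norm on the fixed space of \<open>P\<close> and the construction of
  \<open>h\<close>\<close>

context jordan_char_two
begin

text \<open>\<open>shift M 1\<close> is the action on functions on \<open>V^P\<close>, so these are
  the conjugates of \<open>x_0\<close> in the regular representation of \<open>G/P\<close>.\<close>

definition y :: "nat \<Rightarrow> 'k mpoly" where "y i = (shift M 1 ^^ i) (coord 0)"

lemma y_Suc: "y (Suc i) = shift M 1 (y i)" and y_0: "y 0 = coord 0"
  by (simp_all add: y_def)

lemma pd_y: "i \<le> n \<Longrightarrow> n < M \<Longrightarrow> pd n (y i) = (if i = n then 1 else 0)"
proof (induction i arbitrary: n)
  case 0
  then show ?case by (simp add: y_0 pd_coord)
next
  case (Suc i)
  then show ?case by (auto simp: y_Suc pd_shift Suc_le_eq)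
qed

definition u :: "'k mpoly" where "u = pds [0..<f] (\<Prod>i<M. y i)"

lemma pds_upt_Suc: "a \<le> b \<Longrightarrow> pds [a..<Suc b] p = pds [a..<b] (pd b p)"
  by (simp add: pds_append)

text \<open>As in \<open>theta_sg\<close>, but the range starts at 0, so there is no boundary
  term.\<close>

lemma pds_shift_M: "n \<le> M \<Longrightarrow> pds [0..<n] (shift M 1 p) = shift M 1 (pds [0..<n] (p :: 'k mpoly))"
proof (induction n arbitrary: p)
  case (Suc n)
  have "pds [0..<n] (pd (n - 1) p) = 0" if "n > 0"
    using that by (intro pds_member_pd) auto
  then show ?case
    using Suc by (auto simp: pds_upt_Suc pd_shift Suc_le_eq simp del: upt_Suc)
qed simp

lemma shift_u: "shift M 1 u = u"
proof -
  have "(shift M 1 ^^ 2 ^ Suc e) (coord 0 :: 'k mpoly) = shift M (2 ^ Suc e * 1) (coord 0)" by (rule shift_power)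
  from this[folded M_eq] have "y M = y 0"
    by (simp add: y_def shift_large)
  moreover have "M > 0" using m_pos by (simp add: M_def)
  ultimately have "shift M 1 (\<Prod>i<M. y i) = (\<Prod>i<M. y i)"
    using prod_cyclic_shift[of y M]
    by (simp add: shift_def subst_prod) (simp add: y_Suc shift_def)
  then show ?thesis
    using pds_shift_M[of f "\<Prod>i<M. y i"] f_less_M by (simp add: u_def)
qed

text \<open>Triangularity: among the factors \<open>y 0, ..., y n\<close> only the last has a
  nonzero derivative in \<open>x_n\<close>.\<close>

lemma pds_prod_y: "n \<le> M \<Longrightarrow> pds [0..<n] (\<Prod>i<n. y i) = 1"
proof (induction n)
  case (Suc n)
  have "pd n (\<Prod>i<n. y i) = 0"
    using Suc.prems by (intro pd_prod_zero) (auto simp: pd_y)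
  then have "pd n (\<Prod>i<Suc n. y i) = (\<Prod>i<n. y i)"
    using Suc.prems by (simp add: pd_mult pd_y)
  then show ?case using Suc by (simp add: pds_upt_Suc del: upt_Suc prod.lessThan_Suc)
qed simp

lemma theta_u: "theta u = 1"
proof -
  have "pds [f..<M] u = pds ([0..<f] @ [f..<M]) (\<Prod>i<M. y i)"
    unfolding u_def pds_append by (rule pds_pds)
  also have "[0..<f] @ [f..<M] = [0..<M]"
    using upt_add_eq_append[of 0 f "M - f"] f_less_M by simp
  finally show ?thesis using pds_prod_y[of M] by (simp add: theta_def)
qed

text \<open>The action of \<open>shift M 1\<close> when \<open>x_i\<close> with \<open>i < f\<close>
  stands for its own square; hence the square of \<open>x_f\<close> in the image of
  \<open>x_(f-1)\<close>.\<close>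

definition sg0 :: "'k mpoly \<Rightarrow> 'k mpoly" where
  "sg0 = subst (\<lambda>i. coord i + (if Suc i = f then coord f ^ 2 else if Suc i < M then coord (Suc i) else 0))"

text \<open>The stand-in for the square of \<open>x_i\<close> becomes the \<open>P\<close>-norm of
  \<open>x_i\<close>; coordinates that vanish on \<open>V^P\<close> are sent to 0.\<close>

definition ev :: "'k mpoly \<Rightarrow> 'k mpoly" where
  "ev = subst (\<lambda>i. if i < f then coord i * tau (coord i) else if i < M then coord i else 0)"

lemma square_vars_sg0: "square_vars f (sg0 p) = shift M 1 (square_vars f p)"
  unfolding square_vars_def sg0_def shift_def subst_subst
  using f_less_M
  by (intro arg_cong[where f = "\<lambda>s. subst s p"]) (auto simp: fun_eq_iff square_add)

text \<open>The derivatives of \<open>u\<close> in \<open>x_j\<close> with \<open>j < f\<close>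
  repeat an index and vanish. Invariance descends to \<open>u0\<close> because
  \<open>square_vars\<close> is injective.\<close>

lemma ex_u0: "\<exists>u0. u = square_vars f u0 \<and> sg0 u0 = u0"
proof -
  have "\<forall>j<f. pd j u = 0"
    using pds_member_pd[of _ "[0..<f]"] by (auto simp: u_def pds_pd)
  then obtain u0 where u0: "u = square_vars f u0" using square_vars_exists by blast
  have "square_vars f (sg0 u0 + u0) = 0"
    using shift_u unfolding u0 square_vars_sg0[symmetric] by (simp add: square_vars_def)
  then have "sg0 u0 + u0 = 0" by (rule square_vars_inj)
  then show ?thesis using u0 by (auto simp: add_eq_0_iff')
qed

lemma tau_ev: "tau (ev p) = ev p"
proof -
  have 1: "comm_ring_hom tau" unfolding tau_def by (rule shift_hom)
  have 2: "comm_ring_hom ev" unfolding ev_def by (rule subst_hom)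
  show ?thesis
    by (rule mpoly_hom_eqI[OF comm_ring_hom_comp[OF 1 2] 2])
       (use f_less_M in \<open>auto simp: ev_def tau_coord mult.commute\<close>)
qed

text \<open>\<open>ev\<close> is equivariant up to transfers from \<open>P\<close>. These absorb
  factors fixed by \<open>tau\<close>, which handles products and leaves the coordinates.\<close>

lemma ev_sg0: "\<exists>h. sg (ev p) + ev (sg0 p) = h + tau h"
proof (induction p rule: mpoly_ring_induct)
  case (const c)
  show ?case by (rule exI[of _ 0]) (simp add: ev_def sg0_def)
next
  case (coord i)
  have M: "M < t" "f < M" "0 < f" using f_less_M f_pos by (auto simp: t_def)
  consider "i < f" | "f \<le> i" "Suc i < M" | "Suc i = M" | "M \<le> i" using M by linarith
  then show ?case
  proof cases
    case 1
    \<comment> \<open>The cross terms of the norm of \<open>x_i + x_(i+1)\<close> are conjugate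
      under \<open>tau\<close>, hence form a transfer. For \<open>i + 1 = f\<close> the norm of
      \<open>x_f\<close> is its square, in accordance with \<open>sg0\<close>.\<close>
    have s: "ev (sg0 (coord i)) = coord i * tau (coord i) + coord (Suc i) * tau (coord (Suc i))"
      using 1 M by (auto simp: ev_def sg0_def tau_coord power2_eq_square)
    have "sg (ev (coord i)) = (coord i + coord (Suc i)) * tau (coord i + coord (Suc i))"
      using 1 M by (simp add: ev_def sg_tau sg_coord)
    then show ?thesis
      by (intro exI[of _ "coord i * tau (coord (Suc i))"]) (simp add: s algebra_simps)
  next
    case 2
    then show ?thesis using M
      by (intro exI[of _ 0]) (auto simp: ev_def sg0_def sg_coord)
  next
    case 3
    \<comment> \<open>The surplus \<open>x_M\<close> is \<open>x_0 + tau x_0\<close>, a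
      transfer.\<close>
    then have "sg (ev (coord i)) = coord i + coord M" using M by (simp add: ev_def sg_coord)
    moreover have "ev (sg0 (coord i)) = coord i" using 3 M by (auto simp: ev_def sg0_def)
    ultimately show ?thesis using M
      by (intro exI[of _ "coord 0"]) (simp add: tau_coord add_ac)
  next
    case 4
    then show ?thesis using M by (intro exI[of _ 0]) (auto simp: ev_def sg0_def)
  qed
next
  case (add p q)
  then obtain h1 h2 where "sg (ev p) + ev (sg0 p) = h1 + tau h1" "sg (ev q) + ev (sg0 q) = h2 + tau h2" by blast
  then show ?case
    by (intro exI[of _ "h1 + h2"]) (simp add: ev_def sg0_def add_eq_iff add_ac)
next
  case (mult p q)
  then obtain h1 h2 where h: "sg (ev p) + ev (sg0 p) = h1 + tau h1" "sg (ev q) + ev (sg0 q) = h2 + tau h2" by blast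
  have t: "tau (sg (ev p)) = sg (ev p)" "tau (ev (sg0 q)) = ev (sg0 q)"
    by (simp_all add: sg_tau[symmetric] tau_ev)
  have "sg (ev (p * q)) + ev (sg0 (p * q)) = sg (ev p) * (sg (ev q) + ev (sg0 q)) + (sg (ev p) + ev (sg0 p)) * ev (sg0 q)"
    by (simp add: ev_def sg0_def algebra_simps)
  then show ?case
    unfolding h by (intro exI[of _ "sg (ev p) * h2 + h1 * ev (sg0 q)"]) (simp add: t algebra_simps)
qed

lemma pd_ev: "f \<le> j \<Longrightarrow> j < M \<Longrightarrow> pd j (ev p) = ev (pd j p)"
  unfolding ev_def by (subst pd_subst[where L = "{j}"]) (auto simp: pd_mult tau_coord pd_coord)

lemma pds_ev: "(\<forall>j\<in>set js. f \<le> j \<and> j < M) \<Longrightarrow> pds js (ev p) = ev (pds js p)"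
  by (induction js) (auto simp: pd_ev)

lemma pds_square_vars: "(\<forall>j\<in>set js. n \<le> j) \<Longrightarrow> pds js (square_vars n p) = square_vars n (pds js (p :: 'k mpoly))"
  by (induction js) (auto simp: pd_square_vars)

lemma theta_ev: "theta (ev p) = theta (square_vars f p)"
  by (simp add: theta_def pds_ev pds_square_vars)
     (simp add: ev_def square_vars_def const_term_subst)

text \<open>For \<open>v = ev u0\<close> the polynomial \<open>D v\<close> is a transfer from
  \<open>P\<close>, that is \<open>D^M h\<close> for some \<open>h\<close>. Then
  \<open>v + D^(M-1) h\<close> is invariant and \<open>theta\<close> vanishes on it, while the trace
  of \<open>h\<close> is \<open>D^M v\<close>, which is zero because \<open>v\<close> is fixed by
  \<open>tau\<close>.\<close>

lemma ex_trace_null: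
  "\<exists>h. (D ^^ (2 * M - 1)) h = 0 \<and> theta ((D ^^ (M - 1)) h) = 1"
proof -
  obtain u0 where u0: "u = square_vars f u0" "sg0 u0 = u0" using ex_u0 by blast
  let ?v = "ev u0"
  obtain h where "sg ?v + ev (sg0 u0) = h + tau h" using ev_sg0 by blast
  then have h: "D ?v = (D ^^ M) h" by (simp add: u0 D_M D_def add.commute)
  have M0: "M = Suc (M - 1)" using m_pos by (simp add: M_def)
  define a where "a = ?v + (D ^^ (M - 1)) h"
  have "D a = D ?v + (D ^^ M) h" by (subst M0) (simp add: a_def)
  then have "D a = 0" using h by simp
  then have "sg a = a" by (simp add: D_def add_eq_0_iff')
  then have "(sg ^^ n) a = a" for n by (induction n) auto
  then have "theta a = 0" by (intro theta_qa_fixed) (simp flip: sg_m)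
  moreover have "theta ?v = 1" using theta_u by (simp add: theta_ev u0)
  ultimately have "theta ((D ^^ (M - 1)) h) = 1"
    by (simp add: a_def) (metis add_eq_0_iff add.commute add_self_field)
  moreover have "(D ^^ (2 * M - 1)) h = 0"
  proof -
    have "2 * M - 1 = (M - 1) + M" using M0 by simp
    then have "(D ^^ (2 * M - 1)) h = (D ^^ (M - 1)) ((D ^^ M) h)" by (simp only: funpow_add o_apply)
    also have "\<dots> = (D ^^ M) ?v"
      unfolding h[symmetric] by (subst (2) M0) (simp add: funpow_swap1)
    also have "\<dots> = 0" by (simp add: D_M tau_ev)
    finally show ?thesis .
  qed
  ultimately show ?thesis by blast
qed

text \<open>Equality would give \<open>D^(2M-2) h' = 0\<close> for \<open>h' = h + D g\<close>, so
  \<open>D^(M-2) h'\<close> would be fixed by \<open>tau\<close> and \<open>theta_sg\<close> would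
  yield \<open>theta (D^(M-1) h') = 0\<close>. The contribution of \<open>g\<close> is a transfer
  from \<open>P\<close>, on which \<open>theta\<close> vanishes.\<close>

lemma not_transfer:
  assumes "theta ((D ^^ (M - 1)) h) = 1"
  shows "(D ^^ (2 * M - 2)) h \<noteq> (D ^^ (2 * M - 1)) g"
proof
  assume eq: "(D ^^ (2 * M - 2)) h = (D ^^ (2 * M - 1)) g"
  have M2: "2 \<le> M" using m_pos by (simp add: M_def)
  define h' where "h' = h + D g"
  have "2 * M - 1 = Suc (2 * M - 2)" using M2 by simp
  then have "(D ^^ (2 * M - 2)) h' = 0"
    using eq by (simp add: h'_def funpow_swap1)
  moreover have "2 * M - 2 = M + (M - 2)" using M2 by simp
  ultimately have "(D ^^ M) ((D ^^ (M - 2)) h') = 0" by (simp only: funpow_add o_apply)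
  then have "tau ((D ^^ (M - 2)) h') = (D ^^ (M - 2)) h'" by (simp add: D_M add_eq_0_iff')
  then have "theta (D ((D ^^ (M - 2)) h')) = 0"
    by (simp add: D_def theta_sg add_self_field)
  moreover have M1: "M - 1 = Suc (M - 2)" "M = Suc (M - 1)" using M2 by auto
  ultimately have 1: "theta ((D ^^ (M - 1)) h') = 0" by simp
  have "(D ^^ (M - 1)) h' = (D ^^ (M - 1)) h + (D ^^ M) g"
    using funpow_Suc_right[of "M - 1" D] M1(2) by (simp add: h'_def)
  then have "theta ((D ^^ (M - 1)) h) = 0"
    using 1 by (simp add: D_M theta_tau add_self_field)
  then show False using assms by simp
qed

end


section \<open>The norm of the top coordinate\<close>

definition deg0 :: "'k::comm_ring_1 mpoly \<Rightarrow> nat" where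
  "deg0 p = degree (uni 0 p)"

lemma coeff_0_uni: "Polynomial.coeff (uni j p) 0 = subst (\<lambda>i. if i = j then 0 else coord i) p"
  by (induction p rule: mpoly_ring_induct) (auto simp: uni_coord coeff_mult)

lemma sum_const_poly: "(\<Sum>i\<in>A. [:h i:]) = [:\<Sum>i\<in>A. h i:]"
  by (induction A rule: infinite_finite_induct) auto

lemma uni_coeff_uni: "uni j (Polynomial.coeff (uni j p) n) = [:Polynomial.coeff (uni j p) n:]"
proof (induction p arbitrary: n rule: mpoly_ring_induct)
  case (mult p q)
  interpret comm_ring_hom "uni j" by (rule uni_hom)
  have "uni j (Polynomial.coeff (uni j (p * q)) n) = (\<Sum>i\<le>n. [:Polynomial.coeff (uni j p) i * Polynomial.coeff (uni j q) (n - i):])"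
    by (simp add: coeff_mult hom_sum mult) (simp add: mult.commute)
  also have "\<dots> = [:\<Sum>i\<le>n. Polynomial.coeff (uni j p) i * Polynomial.coeff (uni j q) (n - i):]"
    by (rule sum_const_poly)
  finally show ?case by (simp add: coeff_mult)
next
  case (const c)
  show ?case by (cases n) auto
next
  case (coord i)
  show ?case by (cases n; cases "n - 1") (auto simp: uni_coord coeff_pCons split: nat.splits)
qed simp

lemma degree_0_mult: "degree p = 0 \<Longrightarrow> degree q = 0 \<Longrightarrow> degree (p * q) = 0"
  by (metis add_0 degree_mult_le le_zero_eq)

text \<open>In the expansion by powers of \<open>x_0\<close> the coefficients stay free of
  \<open>x_0\<close> under \<open>s\<close>, and the \<open>i\<close>-th power of \<open>s 0\<close>
  has degree at most \<open>i\<close>.\<close>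

lemma deg0_subst_le:
  fixes s :: "nat \<Rightarrow> 'k::comm_ring_1 mpoly"
  assumes s0: "deg0 (s 0) \<le> 1" and s: "\<And>i. i > 0 \<Longrightarrow> deg0 (s i) = 0"
  shows "deg0 (subst s p) \<le> deg0 p"
proof -
  define z :: "'k mpoly \<Rightarrow> 'k mpoly" where "z = subst (\<lambda>i. if i = 0 then 0 else coord i)"
  have z: "degree (uni 0 (subst s (z p))) = 0" for p
    unfolding z_def
  proof (induction p rule: mpoly_ring_induct)
    case (coord i)
    show ?case
    proof (cases "i = 0")
      case False
      then show ?thesis using s[of i] by (simp add: deg0_def)
    qed simp
  next
    case (add p q)
    then show ?case using degree_add_le[of "uni 0 (subst s (z p))" 0 "uni 0 (subst s (z q))"] by (simp add: z_def)
  next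
    case (mult p q)
    then show ?case by (simp add: degree_0_mult)
  qed simp
  define c where "c i = Polynomial.coeff (uni 0 p) i" for i
  have c: "degree (uni 0 (subst s (c i))) = 0" for i
  proof -
    have "z (c i) = c i" unfolding z_def c_def by (simp add: coeff_0_uni[symmetric] uni_coeff_uni)
    then show ?thesis using z[of "c i"] by simp
  qed
  interpret u: comm_ring_hom "uni (0::nat) :: 'k mpoly \<Rightarrow> _" by (rule uni_hom)
  have "p = (\<Sum>i\<le>deg0 p. c i * coord 0 ^ i)"
    unfolding c_def deg0_def by (subst (1) poly_uni[of 0 p, symmetric]) (rule poly_altdef)
  then have "uni 0 (subst s p) = uni 0 (subst s (\<Sum>i\<le>deg0 p. c i * coord 0 ^ i))" by (rule arg_cong)
  also have "\<dots> = (\<Sum>i\<le>deg0 p. uni 0 (subst s (c i)) * uni 0 (s 0) ^ i)"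
    by (simp add: subst_sum u.hom_sum u.hom_power)
  also have "degree \<dots> \<le> deg0 p"
  proof (rule degree_sum_le)
    fix i assume i: "i \<in> {..deg0 p}"
    have "degree (uni 0 (subst s (c i)) * uni 0 (s 0) ^ i) \<le> degree (uni 0 (s 0) ^ i)"
      using degree_mult_le[of "uni 0 (subst s (c i))" "uni 0 (s 0) ^ i"] by (simp add: c)
    also have "\<dots> \<le> degree (uni 0 (s 0)) * i" by (rule degree_power_le)
    also have "\<dots> \<le> deg0 p" 
      using mult_le_mono[OF s0, of i "deg0 p"] i by (simp add: deg0_def)
    finally show "degree (uni 0 (subst s (c i)) * uni 0 (s 0) ^ i) \<le> deg0 p" .
  qed simp
  finally show ?thesis by (simp add: deg0_def)
qed

text \<open>All iterated derivatives of order below \<open>n\<close> vanish at the origin. In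
  characteristic two this is weaker than membership in the \<open>n\<close>-th power of the maximal
  ideal, as squares of variables show, but it is what \<open>pds\<close> detects.\<close>

primrec vanishes :: "nat \<Rightarrow> 'k::comm_ring_1 mpoly \<Rightarrow> bool" where
  "vanishes 0 p \<longleftrightarrow> True"
| "vanishes (Suc n) p \<longleftrightarrow> const_term p = 0 \<and> (\<forall>j. vanishes n (pd j p))"

lemma vanishes_mono: "vanishes (Suc n) p \<Longrightarrow> vanishes n p"
proof (induction n arbitrary: p)
  case (Suc n)
  then show ?case by (metis vanishes.simps(2))
qed simp

lemma vanishes_add: "vanishes n p \<Longrightarrow> vanishes n q \<Longrightarrow> vanishes n (p + q)"
  by (induction n arbitrary: p q) auto

lemma vanishes_mult: "vanishes n p \<Longrightarrow> vanishes n (p * q)"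
proof (induction n arbitrary: p q)
  case (Suc n)
  then show ?case using vanishes_mono[OF Suc.prems] by (auto simp: pd_mult intro!: vanishes_add)
qed simp

text \<open>In the Leibniz rule either the factor \<open>a\<close> survives and induction applies,
  or \<open>b\<close> keeps its full order.\<close>

lemma vanishes_mult_Suc: "const_term a = 0 \<Longrightarrow> vanishes n b \<Longrightarrow> vanishes (Suc n) (a * b)"
proof (induction n arbitrary: b)
  case (Suc n)
  have "vanishes (Suc n) (pd j (a * b))" for j
  proof -
    have "vanishes (Suc n) (b * pd j a)" using Suc.prems(2) by (rule vanishes_mult)
    moreover have "vanishes (Suc n) (a * pd j b)" using Suc by (intro Suc.IH) auto
    ultimately show ?thesis unfolding pd_mult by (metis vanishes_add mult.commute)
  qed
  then show ?case using Suc.prems(1) by simp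
qed simp

lemma vanishes_pds: "vanishes n p \<Longrightarrow> length js < n \<Longrightarrow> const_term (pds js p) = 0"
proof (induction js arbitrary: n p)
  case Nil
  then show ?case by (cases n) auto
next
  case (Cons j js)
  then obtain n' where "n = Suc n'" by (cases n) auto
  then have "const_term (pds js (pd j p)) = 0" using Cons by auto
  then show ?case by (simp add: pds_pd)
qed

section \<open>The transfer as a power of \<open>D\<close>, and division by the norm\<close>

context jordan_char_two
begin

definition N :: nat where "N = 2 * M"

lemma N_eq: "N = 2 ^ Suc (Suc e)"
  by (simp add: N_def M_eq)

lemma M_ge_2: "2 \<le> M"
  using m_pos by (simp add: M_def)

lemma N_pos: "0 < N"
  using M_ge_2 by (simp add: N_def)

definition Tr :: "'k mpoly \<Rightarrow> 'k mpoly" where "Tr p = (\<Sum>i<N. (sg ^^ i) p)"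

text \<open>Splitting the sum in half gives the factor \<open>1 + sg^(2^n) = D^(2^n)\<close>, and
  \<open>2^n - 1\<close> and \<open>2^n\<close> add up to \<open>2^(n+1) - 1\<close>.\<close>

lemma sum_sg_power: "(\<Sum>i<2 ^ n. (sg ^^ i) p) = (D ^^ (2 ^ n - 1)) p"
proof (induction n arbitrary: p)
  case (Suc n)
  have lt: "{..<2 ^ Suc n} = {..<(2::nat) ^ n} \<union> {2 ^ n..<2 ^ Suc n}" by auto
  have "(\<Sum>i<2 ^ Suc n. (sg ^^ i) p) = (\<Sum>i<2 ^ n. (sg ^^ i) p) + (\<Sum>i\<in>{2 ^ n..<2 ^ Suc n}. (sg ^^ i) p)"
    unfolding lt by (rule sum.union_disjoint) auto
  also have "(\<Sum>i\<in>{2 ^ n..<2 ^ Suc n}. (sg ^^ i) p) = (\<Sum>i<2 ^ n. (sg ^^ (i + 2 ^ n)) p)"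
    using sum.shift_bounds_nat_ivl[of "\<lambda>i. (sg ^^ i) p" 0 "2 ^ n" "2 ^ n"] by (simp add: atLeast0LessThan mult_2)
  also have "(\<Sum>i<2 ^ n. (sg ^^ i) p) + \<dots> = (\<Sum>i<2 ^ n. (sg ^^ i) ((D ^^ 2 ^ n) p))"
    by (simp add: D_power funpow_add sum.distrib add_ac)
  also have "\<dots> = (D ^^ (2 ^ n - 1 + 2 ^ n)) p"
    unfolding Suc by (simp only: funpow_add o_apply)
  also have "2 ^ n - 1 + 2 ^ n = (2 :: nat) ^ Suc n - 1" by simp
  finally show ?case .
qed simp

lemma Tr_eq_D: "Tr p = (D ^^ (N - 1)) p"
  unfolding Tr_def N_eq by (rule sum_sg_power)

lemma Tr_add: "Tr (p + q) = Tr p + Tr q"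
  by (simp add: Tr_eq_D)

lemma t_less_N: "t \<le> N" and t_gt_1: "1 < t"
  using f_less_M M_ge_2 by (auto simp: t_def N_def)

lemma sg_N: "(sg ^^ N) p = p"
  unfolding N_eq sg_power using t_less_N unfolding N_eq by (rule shift_large)

lemma D_funpow_mult_fixed: "sg v = v \<Longrightarrow> (D ^^ n) (v * p) = v * (D ^^ n) p"
  by (induction n) (auto simp: D_def algebra_simps)

lemma sg_funpow_fixed: "sg v = v \<Longrightarrow> (sg ^^ n) v = v"
  by (induction n) auto

definition nrm :: "'k mpoly" where "nrm = (\<Prod>i<N. (sg ^^ i) (coord 0))"

lemma sg_prod: "sg (\<Prod>x\<in>A. h x) = (\<Prod>x\<in>A. sg (h x))"
  by (simp add: sg_def shift_def subst_prod)

lemma sg_nrm: "sg nrm = nrm"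
proof -
  have "sg nrm = (\<Prod>i<N. (sg ^^ Suc i) (coord 0))"
    by (simp add: nrm_def sg_prod)
  also have "\<dots> = nrm" unfolding nrm_def
    by (rule prod_cyclic_shift) (simp_all add: sg_N N_pos)
  finally show ?thesis .
qed

lemma deg0_sg: "deg0 (sg p) \<le> deg0 p"
  unfolding sg_def shift_def by (rule deg0_subst_le) (auto simp: deg0_def uni_coord)

lemma deg0_add_less: "deg0 p < n \<Longrightarrow> deg0 q < n \<Longrightarrow> deg0 (p + q) < n"
  unfolding deg0_def by (simp add: degree_add_less)

lemma deg0_D_funpow: "deg0 p < n \<Longrightarrow> deg0 ((D ^^ k) p) < n"
  by (induction k) (auto simp: D_def intro!: deg0_add_less le_less_trans[OF deg0_sg])

lemma uni_sg_funpow: "\<exists>l. uni 0 ((sg ^^ i) (coord 0)) = [:l, 1:]"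
proof -
  have "(sg ^^ i) (coord 0) = coord 0 + ((sg ^^ i) (coord 0) + coord 0)" by (simp add: add.commute)
  from arg_cong[OF this, of "uni 0"]
  have "uni 0 ((sg ^^ i) (coord 0)) = [:0, 1:] + uni 0 ((sg ^^ i) (coord 0) + coord 0)"
    by (subst (asm) uni_simps(3)) (simp only: uni_coord simp_thms if_True)
  moreover have "deg0 ((sg ^^ i) (coord 0) + coord 0) = 0"
  proof (induction i)
    case 0
    then show ?case by (simp add: deg0_def)
  next
    case (Suc i)
    have "(sg ^^ Suc i) (coord 0) + coord 0 = sg ((sg ^^ i) (coord 0) + coord 0) + coord 1"
      using t_gt_1 by (simp add: sg_coord add_ac)
    moreover have "deg0 (sg ((sg ^^ i) (coord 0) + coord 0)) < 1" 
      by (rule le_less_trans[OF deg0_sg]) (simp add: Suc)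
    moreover have "deg0 (coord 1 :: 'k mpoly) < 1" by (simp add: deg0_def uni_coord)
    ultimately have "deg0 ((sg ^^ Suc i) (coord 0) + coord 0) < 1" by (simp only: deg0_add_less)
    then show ?case by simp
  qed
  then obtain c where "uni 0 ((sg ^^ i) (coord 0) + coord 0) = [:c:]" unfolding deg0_def by (rule degree_eq_zeroE)
  ultimately have "uni 0 ((sg ^^ i) (coord 0)) = [:0, 1:] + [:c:]" by (simp only:)
  then show ?thesis by simp
qed

lemma nrm_monic: "lead_coeff (uni 0 nrm) = 1" and deg0_nrm: "deg0 nrm = N"
proof -
  obtain l where l: "\<And>i. uni 0 ((sg ^^ i) (coord 0)) = [:l i, 1:]" using uni_sg_funpow by metis
  interpret comm_ring_hom "uni 0 :: 'k mpoly \<Rightarrow> _" by (rule uni_hom)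
  have "uni 0 nrm = (\<Prod>i<N. [:l i, 1:])" by (simp add: nrm_def hom_prod l)
  moreover have "lead_coeff (\<Prod>i<N. [:l i, 1:]) = 1"
    by (simp only: lead_coeff_prod) simp
  moreover have "degree (\<Prod>i<N. [:l i, 1:]) = N"
    by (subst degree_prod_eq_sum_degree) auto
  ultimately show "lead_coeff (uni 0 nrm) = 1" "deg0 nrm = N"
    by (simp_all only: deg0_def)
qed

lemma nrm_multiple_eq_0:
  assumes "deg0 (nrm * q) < N"
  shows "q = 0"
proof (rule ccontr)
  assume "q \<noteq> 0"
  have "nrm \<noteq> 0"
  proof
    assume "nrm = 0"
    then show False using nrm_monic by simp
  qed
  then have "deg0 (nrm * q) = deg0 nrm + deg0 q"
    using \<open>q \<noteq> 0\<close> unfolding deg0_def uni_simps by (intro degree_mult_eq) auto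
  then show False using assms deg0_nrm by simp
qed

text \<open>\<open>nrm\<close> is monic in \<open>x_0\<close>. Multiplying a remainder by a
  coordinate raises its degree by at most one, so a single correction by the coefficient at
  \<open>x_0^N\<close> suffices.\<close>

lemma nrm_division: "\<exists>q b. p = nrm * q + b \<and> deg0 b < N"
proof (induction p rule: mpoly_induct)
  case (const c)
  show ?case by (rule exI[of _ 0], rule exI[of _ "const c"]) (simp add: deg0_def N_pos)
next
  case (add p p')
  then obtain q b q' b' where "p = nrm * q + b" "deg0 b < N" "p' = nrm * q' + b'" "deg0 b' < N" by blast
  moreover from this have "p + p' = nrm * (q + q') + (b + b')" by (simp only: distrib_left add_ac)
  ultimately show ?case using deg0_add_less by blast
next
  case (mult i p)
  then obtain q b where p: "p = nrm * q + b" and b: "deg0 b < N" by blast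
  have le: "deg0 (coord i * b) \<le> N"
  proof -
    have "degree (uni 0 (coord i :: 'k mpoly)) \<le> 1" by (auto simp: uni_coord)
    then show ?thesis using degree_mult_le[of "uni 0 (coord i)" "uni 0 b"] b by (simp add: deg0_def)
  qed
  define c where "c = Polynomial.coeff (uni 0 (coord i * b)) N"
  define b' where "b' = coord i * b + nrm * c"
  have u: "uni 0 b' = uni 0 (coord i * b) + uni 0 nrm * [:c:]"
    unfolding b'_def uni_simps using uni_coeff_uni[of 0 "coord i * b" N] by (simp add: c_def)
  have "degree (uni 0 nrm * [:c:]) \<le> N"
    using degree_mult_le[of "uni 0 nrm" "[:c:]"] deg0_nrm by (simp add: deg0_def)
  then have "deg0 b' \<le> N" unfolding deg0_def u using le by (auto simp: deg0_def intro!: degree_add_le)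
  moreover have "Polynomial.coeff (uni 0 b') N = 0"
    unfolding u using nrm_monic deg0_nrm by (simp add: c_def deg0_def mult.commute[of _ "[:_:]"])
  moreover have "deg0 b' \<noteq> N"
  proof
    assume deg: "deg0 b' = N"
    then have "lead_coeff (uni 0 b') = 0" using \<open>Polynomial.coeff (uni 0 b') N = 0\<close> by (simp add: deg0_def)
    then have "b' = 0" by simp
    then show False using deg N_pos by (simp add: deg0_def)
  qed
  ultimately have "deg0 b' < N" by simp
  moreover have "nrm * (coord i * q + c) + b' = coord i * p + (nrm * c + nrm * c)"
    unfolding b'_def p by (simp only: distrib_left add_ac mult_ac)
  ultimately show ?case
    by (intro exI[of _ "coord i * q + c"] exI[of _ b']) simp
qed

lemma Tr_nrm: "Tr (nrm * q) = nrm * Tr q"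
  by (simp add: Tr_eq_D D_funpow_mult_fixed sg_nrm)

lemma deg0_Tr: "deg0 b < N \<Longrightarrow> deg0 (Tr b) < N"
  by (simp add: Tr_eq_D deg0_D_funpow)

text \<open>\<open>Tr\<close> respects the division: for \<open>g = nrm * q + b\<close> the product
  \<open>nrm * (p + Tr q)\<close> equals \<open>Tr b\<close>, whose degree in \<open>x_0\<close> is
  below \<open>N\<close>, so both vanish.\<close>

lemma nrm_regular:
  assumes "nrm * p = Tr g"
  shows "\<exists>g'. p = Tr g'"
proof -
  obtain q b where g: "g = nrm * q + b" "deg0 b < N" using nrm_division[of g] by blast
  have "nrm * (p + Tr q) = Tr g + nrm * Tr q"
    by (simp only: distrib_left assms)
  also have "\<dots> = Tr b"
    unfolding g(1) Tr_add Tr_nrm by (simp add: add.commute)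
  finally have "nrm * (p + Tr q) = Tr b" .
  then have "p + Tr q = 0" using deg0_Tr[OF g(2)] by (intro nrm_multiple_eq_0) simp
  then show ?thesis by (auto simp: add_eq_0_iff')
qed

text \<open>\<open>nrm\<close> is a product of \<open>N\<close> factors without constant term, while
  \<open>theta\<close> takes fewer than \<open>N\<close> derivatives.\<close>

lemma theta_nrm: "theta (nrm * p) = 0"
proof -
  have "vanishes n (\<Prod>i<n. (sg ^^ i) (coord 0))" for n
  proof (induction n)
    case (Suc n)
    have "vanishes (Suc n) ((sg ^^ n) (coord 0) * (\<Prod>i<n. (sg ^^ i) (coord 0)))"
      by (rule vanishes_mult_Suc) (simp_all add: Suc)
    then show ?case by (simp only: prod.lessThan_Suc mult.commute)
  qed simp
  then have "vanishes N (nrm * p)" unfolding nrm_def by (intro vanishes_mult)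
  moreover have "length [f..<M] < N" using M_ge_2 by (auto simp: N_def)
  ultimately show ?thesis unfolding theta_def by (rule vanishes_pds)
qed

section \<open>Truncation to \<open>t\<close> variables and the choice of the witness\<close>

definition proj :: "'k mpoly \<Rightarrow> 'k mpoly" where
  "proj = subst (\<lambda>i. if i < t then coord i else 0)"

lemma proj_in_polys: "proj p \<in> polys t"
  unfolding proj_def
proof (induction p rule: mpoly_ring_induct)
  case (coord i)
  show ?case by (auto intro: polys_coord)
qed (auto intro: polys_const polys_add polys_mult)

lemma proj_polys: "p \<in> polys t \<Longrightarrow> proj p = p"
  using subst_cong_polys[of p t coord] by (simp add: proj_def)

lemma proj_add [simp]: "proj (p + q) = proj p + proj q" and proj_mult [simp]: "proj (p * q) = proj p * proj q"
  by (simp_all add: proj_def)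

text \<open>Truncation is equivariant, so elements constructed in infinitely many variables can be
  moved into \<open>polys t\<close> afterwards.\<close>

lemma proj_sg: "proj (sg p) = sg (proj p)"
  unfolding proj_def sg_def shift_def subst_subst
  by (rule arg_cong[where f = "\<lambda>s. subst s p"]) auto

lemma proj_D_funpow: "proj ((D ^^ n) p) = (D ^^ n) (proj p)"
  by (induction n) (auto simp: D_def proj_sg)

lemma sg_polys: "p \<in> polys t \<Longrightarrow> sg p \<in> polys t"
  using proj_in_polys[of "sg p"] by (simp add: proj_sg proj_polys)

lemma sg_funpow_polys: "p \<in> polys t \<Longrightarrow> (sg ^^ n) p \<in> polys t"
  by (induction n) (auto intro: sg_polys)

lemma nrm_polys: "nrm \<in> polys t"
  unfolding nrm_def using t_gt_1 by (intro polys_prod sg_funpow_polys polys_coord) auto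

lemma pds_proj: "(\<forall>j\<in>set js. j < t) \<Longrightarrow> pds js (proj p) = proj (pds js p)"
proof (induction js)
  case (Cons j js)
  have "pd j (proj q) = proj (pd j q)" for q
    unfolding proj_def by (subst pd_subst[where L = "{j}"]) (use Cons.prems in \<open>auto simp: pd_coord\<close>)
  then show ?case using Cons by simp
qed simp

lemma theta_proj: "theta (proj p) = theta p"
  unfolding theta_def by (subst pds_proj) (auto simp: t_def proj_def const_term_subst)

lemma deg0_proj: "deg0 (proj p) \<le> deg0 p"
  unfolding proj_def using t_gt_1 by (intro deg0_subst_le) (auto simp: deg0_def uni_coord)

text \<open>The element of \<open>ex_trace_null\<close> is replaced by its remainder modulo
  \<open>nrm\<close> and truncated; the relevant value of \<open>theta\<close> does not change. The
  bound on the degree in \<open>x_0\<close> then reduces the claim to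
  \<open>not_transfer\<close>.\<close>

lemma ex_witness:
  obtains h where "h \<in> polys t" "Tr h = 0" "\<And>a g. (D ^^ (N - 2)) h \<noteq> nrm * a + Tr g"
proof -
  obtain h0 where h0: "(D ^^ (2 * M - 1)) h0 = 0" "theta ((D ^^ (M - 1)) h0) = 1"
    using ex_trace_null by blast
  obtain q b where qb: "h0 = nrm * q + b" "deg0 b < N" using nrm_division[of h0] by blast
  have "nrm * Tr q = Tr b" 
  proof -
    have "Tr h0 = 0" using h0(1) by (simp add: Tr_eq_D N_def)
    then show ?thesis by (simp add: qb(1) Tr_add Tr_nrm add_eq_0_iff')
  qed
  then have "Tr q = 0" using deg0_Tr[OF qb(2)] by (intro nrm_multiple_eq_0) simp
  with \<open>nrm * Tr q = Tr b\<close> have Trb: "Tr b = 0" by simp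
  have thb: "theta ((D ^^ (M - 1)) b) = 1"
    using h0(2) by (simp add: qb(1) D_funpow_mult_fixed sg_nrm theta_nrm)
  define h where "h = proj b"
  have 1: "theta ((D ^^ (M - 1)) h) = 1"
    using thb by (simp add: h_def proj_D_funpow[symmetric] theta_proj)
  have 2: "deg0 h < N" using qb(2) deg0_proj[of b] by (simp add: h_def)
  have "Tr h = proj (Tr b)" by (simp add: h_def Tr_eq_D proj_D_funpow)
  then have 3: "Tr h = 0" using Trb by (simp add: proj_def)
  have 4: "(D ^^ (N - 2)) h \<noteq> nrm * a + Tr g" for a g
  proof
    assume eq: "(D ^^ (N - 2)) h = nrm * a + Tr g"
    \<comment> \<open>Once \<open>g\<close> is reduced too, all terms except the multiple of
      \<open>nrm\<close> have degree below \<open>N\<close>, so that multiple vanishes.\<close>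
    obtain q b where g: "g = nrm * q + b" "deg0 b < N" using nrm_division[of g] by blast
    have eq': "nrm * (a + Tr q) = (D ^^ (N - 2)) h + Tr b"
    proof -
      have "nrm * (a + Tr q) = nrm * a + (nrm * Tr q + Tr b) + Tr b"
        by (simp add: distrib_left add.assoc)
      then show ?thesis unfolding eq g(1) Tr_add Tr_nrm .
    qed
    have "a + Tr q = 0"
      by (rule nrm_multiple_eq_0) (unfold eq', intro deg0_add_less deg0_D_funpow deg0_Tr 2 g)
    then have "(D ^^ (N - 2)) h = Tr b" using eq' by (simp add: add_eq_0_iff')
    then show False using not_transfer[OF 1, of b] by (simp add: N_def Tr_eq_D)
  qed
  show ?thesis by (rule that[OF _ 3 4]) (simp add: h_def proj_in_polys)
qed

end


section \<open>Nilpotency on the witness\<close>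

context jordan_char_two
begin

definition annih :: "'k mpoly \<Rightarrow> 'k mpoly set" where
  "annih w = {b. sg b = b \<and> (\<exists>g. b * w = Tr g)}"

lemma annihI: "sg b = b \<Longrightarrow> b * w = Tr g \<Longrightarrow> b \<in> annih w"
  unfolding annih_def by blast

lemma annihE:
  assumes "b \<in> annih w"
  obtains g where "sg b = b" "b * w = Tr g"
  using assms unfolding annih_def by blast

lemma annih_0: "0 \<in> annih w"
  by (rule annihI[where g = 0]) (simp_all add: Tr_eq_D)

lemma annih_add:
  assumes "a \<in> annih w" "b \<in> annih w"
  shows "a + b \<in> annih w"
proof -
  obtain g g' where g: "sg a = a" "a * w = Tr g" "sg b = b" "b * w = Tr g'"
    using annihE[OF assms(1)] annihE[OF assms(2)] by metis
  show ?thesis by (rule annihI[where g = "g + g'"]) (simp_all only: sg_simps g distrib_right Tr_add)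
qed

lemma Tr_mult_fixed: "sg v = v \<Longrightarrow> Tr (v * p) = v * Tr p"
  by (simp add: Tr_eq_D D_funpow_mult_fixed)

lemma annih_mult:
  assumes "a \<in> annih w" "sg s = s"
  shows "a * s \<in> annih w"
proof -
  obtain g where g: "sg a = a" "a * w = Tr g" using annihE[OF assms(1)] .
  have "a * s * w = s * (a * w)" by (simp only: mult_ac)
  then show ?thesis
    by (intro annihI[where g = "s * g"]) (simp_all only: sg_simps g assms(2) Tr_mult_fixed[OF assms(2)])
qed

text \<open>The extension of the ideal \<open>annih w\<close> to the invariants of the subgroup
  generated by \<open>sg ^^ 2 ^ n\<close>. Level 0 is \<open>annih w\<close> itself; at level
  \<open>e + 2\<close> the ring is the whole polynomial ring.\<close>

inductive_set ext :: "'k mpoly \<Rightarrow> nat \<Rightarrow> 'k mpoly set" for w n where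
  zero: "0 \<in> ext w n"
| step: "T \<in> annih w \<Longrightarrow> (sg ^^ 2 ^ n) s = s \<Longrightarrow> x \<in> ext w n \<Longrightarrow> T * s + x \<in> ext w n"

lemma ext_add: "x \<in> ext w n \<Longrightarrow> x' \<in> ext w n \<Longrightarrow> x + x' \<in> ext w n"
  by (induction x rule: ext.induct) (auto simp: add.assoc intro: ext.step)

lemma ext_single: "T \<in> annih w \<Longrightarrow> (sg ^^ 2 ^ n) s = s \<Longrightarrow> T * s \<in> ext w n"
  using ext.step[OF _ _ ext.zero] by fastforce

lemma ext_mult: "x \<in> ext w n \<Longrightarrow> (sg ^^ 2 ^ n) v = v \<Longrightarrow> x * v \<in> ext w n"
proof (induction x rule: ext.induct)
  case (step T s x)
  have "T * (s * v) + x * v \<in> ext w n" using step by (intro ext.step) auto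
  then show ?case by (simp add: algebra_simps)
qed (simp add: ext.zero)

lemma ext_0_subset: "x \<in> ext w 0 \<Longrightarrow> x \<in> annih w"
  by (induction x rule: ext.induct) (auto intro: annih_0 annih_add annih_mult)

text \<open>The expression is bilinear; for \<open>T * s\<close> and \<open>T' * s'\<close> the
  invariant factors come out, and what remains is a relative transfer, fixed by
  \<open>sg ^^ 2 ^ n\<close>.\<close>

lemma ext_conj_pair:
  assumes "x \<in> ext w (Suc n)" "x' \<in> ext w (Suc n)"
  shows "x * (sg ^^ 2 ^ n) x' + (sg ^^ 2 ^ n) x * x' \<in> ext w n"
  using assms(1)
proof (induction x rule: ext.induct)
  case zero
  then show ?case by (simp add: ext.zero)
next
  case (step T s x)
  let ?q = "sg ^^ 2 ^ n"
  have qq: "?q (?q v) = v" if "(sg ^^ 2 ^ Suc n) v = v" for v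
    using that by (simp add: mult_2 funpow_add)
  have qT: "?q T = T" if "T \<in> annih w" for T
    using that by (intro sg_funpow_fixed) (auto simp: annih_def)
  have "T * s * ?q x' + T * ?q s * x' \<in> ext w n"
    using assms(2)
  proof (induction x' rule: ext.induct)
    case zero
    then show ?case by (simp add: ext.zero)
  next
    case (step T' s' x')
    have "T * T' \<in> annih w"
      using \<open>T \<in> annih w\<close> step(1) by (intro annih_mult) (auto simp: annih_def)
    then have "T * T' * (s * ?q s' + ?q s * s') \<in> ext w n"
      by (rule ext_single) (simp add: qq[OF step(2)] qq[OF \<open>(sg ^^ 2 ^ Suc n) s = s\<close>] add.commute)
    from ext_add[OF this step(4)] show ?case
      by (simp add: qT[OF step(1)] algebra_simps)
  qed
  from ext_add[OF this step(4)] show ?case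
    by (simp add: qT[OF step(1)] algebra_simps)
qed

text \<open>Norms descend the chain of subgroups \<open>\<langle>sg\<^bsup>2^n\<^esup>\<rangle>\<close> one step at a time; this
  replaces the integrality of the polynomial ring over the invariants.\<close>

lemma ext_norm:
  assumes "x \<in> ext w (Suc n)"
  shows "x * (sg ^^ 2 ^ n) x \<in> ext w n"
  using assms
proof (induction x rule: ext.induct)
  case zero
  then show ?case by (simp add: ext.zero)
next
  case (step T s x)
  let ?q = "sg ^^ 2 ^ n"
  have T: "sg T = T" using step(1) by (rule annihE)
  then have qT: "?q T = T" by (rule sg_funpow_fixed)
  have qq: "?q (?q s) = s" using step(2) by (simp add: mult_2 funpow_add)
  have "T * T * (s * ?q s) \<in> ext w n"
    using step(1) T by (intro ext_single annih_mult) (simp_all add: qq mult.commute)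
  \<comment> \<open>The norm of a sum is the sum of both norms and a mixed term, which
    \<open>ext_conj_pair\<close> covers.\<close>
  moreover have "T * s \<in> ext w (Suc n)" using step by (intro ext_single)
  then have "T * s * ?q x + ?q (T * s) * x \<in> ext w n" using step(3) by (rule ext_conj_pair)
  ultimately have "T * T * (s * ?q s) + ((T * s * ?q x + ?q (T * s) * x) + x * ?q x) \<in> ext w n"
    using ext_add step(4) by blast
  moreover have "(T * s + x) * ?q (T * s + x) = T * T * (s * ?q s) + ((T * s * ?q x + ?q (T * s) * x) + x * ?q x)"
    by (simp add: qT algebra_simps)
  ultimately show ?case by (simp only:)
qed

text \<open>On an invariant each relative norm is a square, so \<open>n\<close> descents cost the
  exponent \<open>2^n\<close>.\<close>

lemma ext_fixed_power:
  assumes "x \<in> ext w n" "sg x = x"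
  shows "x ^ 2 ^ n \<in> annih w"
  using assms
proof (induction n arbitrary: x)
  case 0
  then show ?case by (simp add: ext_0_subset)
next
  case (Suc n)
  have "x ^ 2 \<in> ext w n"
    using ext_norm[OF Suc.prems(1)] sg_funpow_fixed[OF Suc.prems(2)] by (simp add: power2_eq_square)
  then have "(x ^ 2) ^ 2 ^ n \<in> annih w" by (rule Suc.IH) (simp only: sg_simps Suc.prems)
  then show ?case by (simp only: power_mult[symmetric] power_Suc)
qed

lemma add_power_M: "(p + q) ^ M = p ^ M + (q :: 'k mpoly) ^ M"
  unfolding M_eq by (rule power_two_power_add)

lemma add_power_N: "(p + q) ^ N = p ^ N + (q :: 'k mpoly) ^ N"
  unfolding N_eq by (rule power_two_power_add)

abbreviation ext_full :: "'k mpoly \<Rightarrow> 'k mpoly set" where "ext_full w \<equiv> ext w (Suc (Suc e))"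

lemma ext_full_mult: "x \<in> ext_full w \<Longrightarrow> x * v \<in> ext_full w"
  by (rule ext_mult) (simp_all only: N_eq[symmetric] sg_N)

text \<open>The radical of the extension of \<open>annih w\<close> to the full ring; exponents
  \<open>2^n\<close> make additivity a matter of the Frobenius map.\<close>

definition nilp :: "'k mpoly \<Rightarrow> 'k mpoly set" where
  "nilp w = {p. \<exists>n. p ^ 2 ^ n \<in> ext_full w}"

lemma nilp_level:
  assumes "p ^ 2 ^ n \<in> ext_full w" "n \<le> n'"
  shows "p ^ 2 ^ n' \<in> ext_full w"
proof -
  have "(2::nat) ^ n' = 2 ^ n + (2 ^ n' - 2 ^ n)" using assms(2) by simp
  then have "p ^ 2 ^ n' = p ^ 2 ^ n * p ^ (2 ^ n' - 2 ^ n)" by (simp only: power_add[symmetric])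
  then show ?thesis using ext_full_mult[OF assms(1)] by simp
qed

lemma nilp_add:
  assumes "p \<in> nilp w" "q \<in> nilp w"
  shows "p + q \<in> nilp w"
proof -
  obtain n n' where n: "p ^ 2 ^ n \<in> ext_full w" "q ^ 2 ^ n' \<in> ext_full w"
    using assms unfolding nilp_def by blast
  have "(p + q) ^ 2 ^ max n n' \<in> ext_full w"
    unfolding power_two_power_add
    by (rule ext_add[OF nilp_level[OF n(1)] nilp_level[OF n(2)]]) simp_all
  then show ?thesis unfolding nilp_def by blast
qed

lemma nilp_mult: "p \<in> nilp w \<Longrightarrow> p * q \<in> nilp w"
  unfolding nilp_def mem_Collect_eq power_mult_distrib by (blast intro: ext_full_mult)

lemma nilp_0: "0 \<in> nilp w"
  by (auto simp: nilp_def power_0_left ext.zero)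

lemma nilp_root:
  assumes "p ^ 2 ^ n \<in> nilp w"
  shows "p \<in> nilp w"
proof -
  obtain n' where "(p ^ 2 ^ n) ^ 2 ^ n' \<in> ext_full w" using assms unfolding nilp_def by blast
  then have "p ^ 2 ^ (n + n') \<in> ext_full w" by (simp only: power_mult[symmetric] power_add)
  then show ?thesis unfolding nilp_def by blast
qed

section \<open>Restriction to the subspaces where the later coordinates vanish\<close>

definition cut :: "nat \<Rightarrow> 'k mpoly \<Rightarrow> 'k mpoly" where
  "cut i = subst (\<lambda>j. if i < j \<and> j < t then 0 else coord j)"

lemma cut_simps [simp]:
  "cut i 0 = 0" "cut i 1 = 1" "cut i (p + q) = cut i p + cut i q" "cut i (p * q) = cut i p * cut i q"
  "cut i (p ^ n) = cut i p ^ n" "cut i (const c) = const c"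
  by (simp_all add: cut_def)

lemma cut_prod: "cut i (\<Prod>x\<in>A. h x) = (\<Prod>x\<in>A. cut i (h x))"
  by (simp add: cut_def subst_prod)

lemma cut_coord: "cut i (coord j) = (if i < j \<and> j < t then 0 else coord j)"
  by (simp add: cut_def)

lemma cut_nilp:
  assumes "\<And>j. i < j \<Longrightarrow> j < t \<Longrightarrow> coord j \<in> nilp w"
  shows "p + cut i p \<in> nilp w"
proof (induction p rule: mpoly_induct)
  case (const c)
  then show ?case by (simp add: nilp_0)
next
  case (add p q)
  from nilp_add[OF this] show ?case by (simp add: add_ac)
next
  case (mult j p)
  have "coord j * p + cut i (coord j * p) = (p + cut i p) * coord j + (coord j + cut i (coord j)) * cut i p"
    by (simp add: algebra_simps)
  moreover have "coord j + cut i (coord j) \<in> nilp w"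
    using assms by (auto simp: cut_coord nilp_0)
  then have "(p + cut i p) * coord j + (coord j + cut i (coord j)) * cut i p \<in> nilp w"
    by (rule nilp_add[OF nilp_mult[OF mult] nilp_mult])
  ultimately show ?case by (simp only:)
qed

lemma cut_sg: "cut i (sg p) = cut i (sg (cut i p))"
  unfolding cut_def sg_def shift_def subst_subst
  by (rule arg_cong[where f = "\<lambda>s. subst s p"]) auto

lemma cut_sg_funpow:
  assumes "Suc i < t"
  shows "cut (Suc i) ((sg ^^ n) (coord i)) = coord i + (if odd n then coord (Suc i) else 0)"
proof (induction n)
  case 0
  then show ?case by (simp add: cut_coord)
next
  case (Suc n)
  have "cut (Suc i) ((sg ^^ Suc n) (coord i)) = cut (Suc i) (sg (coord i + (if odd n then coord (Suc i) else 0)))"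
    using Suc by (subst funpow.simps(2), subst o_apply, subst cut_sg) simp
  then show ?case using assms by (auto simp: sg_coord cut_coord add_ac)
qed

lemma cut_0_sg_funpow: "cut 0 ((sg ^^ n) (coord 0)) = coord 0"
proof (induction n)
  case 0
  then show ?case by (simp add: cut_coord)
next
  case (Suc n)
  have "cut 0 ((sg ^^ Suc n) (coord 0)) = cut 0 (sg (coord 0))"
    using Suc by (subst funpow.simps(2), subst o_apply, subst cut_sg) simp
  then show ?case using t_gt_1 by (simp add: sg_coord cut_coord)
qed

lemma sg2: "(sg ^^ 2) p = sg (sg p)"
  by (simp only: numeral_2_eq_2 funpow.simps o_apply id_apply)

lemma D2: "(D ^^ 2) p = (sg ^^ 2) p + p"
  using D_power[of 1 p] by simp

text \<open>As \<open>v\<close> is fixed by \<open>H\<close>, the operator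
  \<open>D^2 = sg^2 + 1\<close> is linear over \<open>v\<close>, and \<open>N - 2\<close> is even.
  Hence \<open>Tr (v * h) = D (v * w)\<close> for \<open>w = D^(N-2) h\<close>, and
  \<open>sg w = w\<close> lets \<open>w\<close> be factored out.\<close>

lemma half_fixed_annih:
  assumes "(sg ^^ 2) v = v" "Tr h = 0"
  shows "v + sg v \<in> annih ((D ^^ (N - 2)) h)"
proof -
  let ?w = "(D ^^ (N - 2)) h"
  have N1: "N - 1 = Suc (N - 2)" and N2: "N - 2 = 2 * (M - 1)" using M_ge_2 by (auto simp: N_def)
  have "D ?w = 0" using assms(2) by (simp only: Tr_eq_D N1 funpow.simps(2) o_apply)
  then have w: "sg ?w = ?w" by (simp add: D_def add_eq_0_iff')
  have "(D ^^ (2 * k)) (v * h) = v * (D ^^ (2 * k)) h" for k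
  proof (induction k)
    case (Suc k)
    have "(D ^^ (2 * Suc k)) p = (D ^^ 2) ((D ^^ (2 * k)) p)" for p
      by (simp add: numeral_2_eq_2)
    then show ?case by (simp only: Suc D2 sg_funpow_simps assms(1) distrib_left)
  qed simp
  then have "Tr (v * h) = D (v * ?w)"
    by (simp only: Tr_eq_D N1 funpow.simps(2) o_apply N2)
  also have "\<dots> = (v + sg v) * ?w" by (simp add: D_def w distrib_right add.commute)
  finally have "(v + sg v) * ?w = Tr (v * h)" ..
  moreover have "sg (v + sg v) = v + sg v" using assms(1) by (simp add: sg2 add.commute)
  ultimately show ?thesis by (intro annihI)
qed

text \<open>Downward induction on \<open>i\<close>. Modulo the later coordinates the
  \<open>H\<close>-norm of \<open>x_(i-1)\<close> is \<open>x_(i-1)^M\<close> and its conjugate is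
  \<open>(x_(i-1) + x_i)^M\<close>, so their sum, a transfer from \<open>H\<close>, becomes
  \<open>x_i^M\<close>.\<close>

lemma coord_nilp:
  assumes "Tr h = 0" "0 < i" "i < t"
  shows "coord i \<in> nilp ((D ^^ (N - 2)) h)"
  using assms(2,3)
proof (induction "t - i" arbitrary: i rule: less_induct)
  case less
  let ?w = "(D ^^ (N - 2)) h"
  obtain i' where i: "i = Suc i'" using less.prems by (cases i) auto
  define v where "v = (\<Prod>j<M. (sg ^^ (2 * j)) (coord i'))"
  have sgv: "sg v = (\<Prod>j<M. (sg ^^ Suc (2 * j)) (coord i'))"
    by (simp add: v_def sg_prod)
  have "(sg ^^ 2) v = (\<Prod>j<M. (sg ^^ (2 * Suc j)) (coord i'))"
    unfolding sg2 sgv sg_prod by simp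
  also have "\<dots> = v"
    unfolding v_def by (rule prod_cyclic_shift) (use M_ge_2 sg_N in \<open>auto simp: N_def\<close>)
  finally have T: "v + sg v \<in> annih ?w" using assms(1) by (intro half_fixed_annih)
  have "cut i v = coord i' ^ M" "cut i (sg v) = (coord i' + coord i) ^ M"
    unfolding sgv unfolding v_def cut_prod
    using less.prems by (simp_all add: i cut_sg_funpow del: funpow.simps)
  then have cutT: "cut i (v + sg v) = coord i ^ M"
    by (simp add: add_power_M)
  have "(v + sg v) + cut i (v + sg v) \<in> nilp ?w"

  proof (rule cut_nilp)
    fix j assume "i < j" "j < t"
    then show "coord j \<in> nilp ?w" using less.prems by (intro less.hyps) simp_all
  qed
  moreover have "v + sg v \<in> ext_full ?w"
    using ext_single[OF T, of "Suc (Suc e)" 1] by simp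
  then have "(v + sg v) ^ 2 ^ 0 \<in> ext_full ?w" by simp
  then have "v + sg v \<in> nilp ?w" unfolding nilp_def by blast
  ultimately have "(v + sg v) + ((v + sg v) + cut i (v + sg v)) \<in> nilp ?w" using nilp_add by blast
  then have "coord i ^ M \<in> nilp ?w" unfolding cutT by (simp only: add_self_left)
  then show ?case unfolding M_eq by (rule nilp_root)
qed

text \<open>\<open>cut 0\<close> restricts to the line \<open>V^G\<close>, where \<open>nrm\<close>
  becomes \<open>x_0^N\<close>; as \<open>N\<close> is a power of two, \<open>N\<close>-th powers
  are additive.\<close>

lemma ex_norm_lift: "p \<in> polys t \<Longrightarrow> \<exists>b. sg b = b \<and> cut 0 b = cut 0 p ^ N"
proof (induction p rule: polys_induct)
  case (const c)
  have "const c ^ n = const (c ^ n)" for n by (induction n) simp_all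
  then show ?case by (intro exI[of _ "const (c ^ N)"]) simp
next
  case (add p q)
  then obtain b b' where "sg b = b" "cut 0 b = cut 0 p ^ N" "sg b' = b'" "cut 0 b' = cut 0 q ^ N" by blast
  then show ?case by (intro exI[of _ "b + b'"]) (simp add: add_power_N)
next
  case (mult i p)
  then obtain b where b: "sg b = b" "cut 0 b = cut 0 p ^ N" by blast
  show ?case
  proof (cases "i = 0")
    case True
    have "cut 0 nrm = coord 0 ^ N" by (simp add: nrm_def cut_prod cut_0_sg_funpow)
    then show ?thesis using b True
      by (intro exI[of _ "nrm * b"]) (simp add: sg_nrm power_mult_distrib cut_coord)
  next
    case False
    then show ?thesis using mult N_pos
      by (intro exI[of _ 0]) (simp add: cut_coord power_0_left)
  qed
qed

text \<open>Once the constant term is removed, a factor \<open>x_0\<close> is available on the line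
  \<open>V^G\<close>, and it lifts to a factor \<open>nrm\<close>.\<close>

lemma ex_norm_multiple:
  assumes "p \<in> polys t"
  shows "\<exists>b. sg b = b \<and> cut 0 (nrm * b) = (cut 0 p + const (const_term p)) ^ N"
proof -
  have "p \<in> polys t \<and> (\<exists>b. sg b = b \<and> cut 0 (nrm * b) = (cut 0 p + const (const_term p)) ^ N)"
    using assms
  proof (induction p rule: polys_induct)
    case (const c)
    then show ?case using N_pos by (auto intro!: exI[of _ 0] polys_const simp: power_0_left)
  next
    case (add p q)
    then obtain b b' where b: "sg b = b" "cut 0 (nrm * b) = (cut 0 p + const (const_term p)) ^ N"
      "sg b' = b'" "cut 0 (nrm * b') = (cut 0 q + const (const_term q)) ^ N" by blast
    have "cut 0 (p + q) + const (const_term (p + q)) = (cut 0 p + const (const_term p)) + (cut 0 q + const (const_term q))"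
      by (simp add: add_ac)
    moreover have "cut 0 (nrm * (b + b')) = cut 0 (nrm * b) + cut 0 (nrm * b')" by (simp add: distrib_left)
    ultimately have "sg (b + b') = b + b' \<and> cut 0 (nrm * (b + b')) = (cut 0 (p + q) + const (const_term (p + q))) ^ N"
      using b by (simp only: sg_simps add_power_N simp_thms)
    then show ?case using add by (blast intro: polys_add)
  next
    case (mult i p)
    obtain b where b: "sg b = b" "cut 0 b = cut 0 p ^ N" using ex_norm_lift mult by blast
    have "cut 0 nrm = coord 0 ^ N" by (simp add: nrm_def cut_prod cut_0_sg_funpow)
    then have "\<exists>b. sg b = b \<and> cut 0 (nrm * b) = (cut 0 (coord i * p) + const (const_term (coord i * p))) ^ N"
      using b mult(1) N_pos
      by (cases "i = 0")
         (auto intro: exI[of _ b] exI[of _ 0] simp: cut_coord power_mult_distrib power_0_left)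
    then show ?case using mult by (auto intro: polys_mult polys_coord)
  qed
  then show ?thesis by blast
qed

text \<open>\<open>p^N\<close> agrees with some multiple \<open>nrm * b\<close> on the line
  \<open>V^G\<close>, so their sum lies in \<open>nilp\<close>. Being invariant, it has a power that
  annihilates the witness modulo transfers; exponents that are powers of two take the sum apart
  again.\<close>

lemma witness_killed:
  assumes "Tr h = 0" "p \<in> polys t" "sg p = p" "const_term p = 0"
  shows "\<exists>n c g. sg c = c \<and> p ^ n * (D ^^ (N - 2)) h = nrm * c * (D ^^ (N - 2)) h + Tr g"
proof -
  let ?w = "(D ^^ (N - 2)) h"
  obtain b where b: "sg b = b" "cut 0 (nrm * b) = (cut 0 p + const (const_term p)) ^ N"
    using ex_norm_multiple[OF assms(2)] by blast
  then have cut_b: "cut 0 (nrm * b) = cut 0 p ^ N" by (simp only: assms(4) const_simps add_0_right)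
  define x where "x = p ^ N + nrm * b"
  have "cut 0 x = 0" unfolding x_def cut_simps(3) cut_b by simp
  moreover have "x + cut 0 x \<in> nilp ?w" by (intro cut_nilp coord_nilp assms(1))
  ultimately have "x \<in> nilp ?w" by simp
  then obtain n where "x ^ 2 ^ n \<in> ext_full ?w" unfolding nilp_def by blast
  moreover have "sg (x ^ 2 ^ n) = x ^ 2 ^ n" by (simp only: x_def sg_simps sg_nrm b(1) assms(3))
  ultimately have "(x ^ 2 ^ n) ^ 2 ^ Suc (Suc e) \<in> annih ?w" by (rule ext_fixed_power)
  then have "x ^ 2 ^ (n + Suc (Suc e)) \<in> annih ?w"
    by (simp only: power_mult[symmetric] power_add[symmetric])
  then obtain g where "x ^ 2 ^ (n + Suc (Suc e)) * ?w = Tr g"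
    unfolding annih_def by blast
  moreover define k where "k = n + Suc (Suc e)"
  ultimately have g: "(p ^ (N * 2 ^ k) + (nrm * b) ^ 2 ^ k) * ?w = Tr g"
    by (simp only: x_def power_two_power_add power_mult)
  have eq: "(nrm * b) ^ 2 ^ k = nrm * (b * (nrm * b) ^ (2 ^ k - 1))"
  proof -
    have "(nrm * b) ^ 2 ^ k = (nrm * b) ^ (2 ^ k - 1) * (nrm * b)" by (rule power_minus_mult[symmetric]) simp
    then show ?thesis by (simp only: mult_ac)
  qed
  have "p ^ (N * 2 ^ k) * ?w = (nrm * b) ^ 2 ^ k * ?w + Tr g"
    unfolding g[symmetric] distrib_right by (simp add: add.commute)
  then have "p ^ (N * 2 ^ k) * ?w = nrm * (b * (nrm * b) ^ (2 ^ k - 1)) * ?w + Tr g"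
    unfolding eq .
  moreover have "sg (b * (nrm * b) ^ (2 ^ k - 1)) = b * (nrm * b) ^ (2 ^ k - 1)"
    by (simp only: sg_simps sg_nrm b(1))
  ultimately show ?thesis by (intro exI conjI)
qed

end


section \<open>Graded depth one\<close>

lemma (in ring) genideal_empty: "Idl {} = {\<zero>}"
proof -
  have "Idl {} \<subseteq> {\<zero>}" by (intro genideal_minimal zeroideal) simp
  moreover have "\<zero> \<in> Idl {}"
    using genideal_ideal[of "{}"] by (simp add: additive_subgroup.zero_closed ideal_def)
  ultimately show ?thesis by blast
qed

lemma (in cring) mem_genideal_singleton_iff:
  assumes "x \<in> carrier R"
  shows "a \<in> Idl {x} \<longleftrightarrow> (\<exists>c\<in>carrier R. a = c \<otimes> x)"
  unfolding cgenideal_eq_genideal[OF assms, symmetric] cgenideal_def by blast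

text \<open>The fraction \<open>w / x\<^sub>0\<close> is a nonzero torsion class in the first local cohomology, which a
  regular pair would exclude.\<close>

lemma (in cring) no_regular_pair:
  assumes x0: "x0 \<in> carrier R" and reg: "\<And>a. a \<in> carrier R \<Longrightarrow> x0 \<otimes> a = \<zero> \<Longrightarrow> a = \<zero>"
    and w: "w \<in> carrier R" "w \<notin> Idl {x0}"
    and y: "y \<in> carrier R" "\<exists>n::nat. y [^] n \<otimes> w \<in> Idl {x0}"
    and z: "z \<in> carrier R" "\<exists>n::nat. z [^] n \<otimes> w \<in> Idl {x0}"
  shows "\<not> regular_sequence R (y # z # xs)"
proof
  assume rs: "regular_sequence R (y # z # xs)"
  interpret P: ideal "Idl {x0}" R by (rule genideal_ideal) (use x0 in simp)
  have ry: "a = \<zero>" if "a \<in> carrier R" "y \<otimes> a = \<zero>" for a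
    using rs that genideal_empty unfolding regular_sequence_def
    by (auto dest!: spec[of _ 0])
  have rz: "a \<in> Idl {y}" if "a \<in> carrier R" "z \<otimes> a \<in> Idl {y}" for a
    using rs that unfolding regular_sequence_def by (auto dest!: spec[of _ "1::nat"])
  \<comment> \<open>The exponent one below the least that moves \<open>u\<close> into the ideal
    gives an element outside it that \<open>x\<close> multiplies into it.\<close>
  have step: "\<exists>v\<in>carrier R. v \<notin> Idl {x0} \<and> x \<otimes> v \<in> Idl {x0} \<and> (\<exists>n::nat. v = x [^] n \<otimes> u)"
    if x: "x \<in> carrier R" and u: "u \<in> carrier R" "u \<notin> Idl {x0}" and ex: "\<exists>n::nat. x [^] n \<otimes> u \<in> Idl {x0}" for x u
  proof -
    define n where "n = (LEAST n::nat. x [^] n \<otimes> u \<in> Idl {x0})"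
    have n: "x [^] n \<otimes> u \<in> Idl {x0}" unfolding n_def using ex by (rule LeastI_ex)
    have "n \<noteq> 0"
    proof
      assume "n = 0"
      then have "x [^] n \<otimes> u = u" using u(1) by simp
      then show False using n u(2) by simp
    qed
    then obtain k where k: "n = Suc k" using not0_implies_Suc by blast
    have "x [^] k \<otimes> u \<notin> Idl {x0}" using not_less_Least[of k "\<lambda>n. x [^] n \<otimes> u \<in> Idl {x0}"] by (simp add: k n_def[symmetric])
    moreover have "x \<otimes> (x [^] k \<otimes> u) = x [^] n \<otimes> u" using x u by (simp add: k m_ac)
    ultimately show ?thesis using n x u by (intro bexI[of _ "x [^] k \<otimes> u"]) auto
  qed
  obtain w1 n where w1: "w1 \<in> carrier R" "w1 \<notin> Idl {x0}" "y \<otimes> w1 \<in> Idl {x0}" "w1 = y [^] (n::nat) \<otimes> w"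
    using step[OF y(1) w y(2)] by blast
  have "\<exists>n::nat. z [^] n \<otimes> w1 \<in> Idl {x0}"
  proof -
    obtain k :: nat where k: "z [^] k \<otimes> w \<in> Idl {x0}" using z(2) by blast
    have "z [^] k \<otimes> w1 = y [^] n \<otimes> (z [^] k \<otimes> w)" using y(1) z(1) w(1) by (simp add: w1(4) m_ac)
    then show ?thesis using P.I_l_closed[OF k, of "y [^] n"] y(1) by (intro exI[of _ k]) simp
  qed
  then obtain w2 k where w2: "w2 \<in> carrier R" "w2 \<notin> Idl {x0}" "z \<otimes> w2 \<in> Idl {x0}" "w2 = z [^] (k::nat) \<otimes> w1"
    using step[OF z(1) w1(1,2)] by blast
  have "y \<otimes> w2 = z [^] k \<otimes> (y \<otimes> w1)" using y(1) z(1) w1(1) by (simp add: w2(4) m_ac)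
  then have "y \<otimes> w2 \<in> Idl {x0}" using P.I_l_closed[OF w1(3), of "z [^] k"] z(1) by simp
  then obtain a where a: "a \<in> carrier R" "y \<otimes> w2 = a \<otimes> x0"
    using mem_genideal_singleton_iff[OF x0] by blast
  obtain b where b: "b \<in> carrier R" "z \<otimes> w2 = b \<otimes> x0"
    using w2(3) mem_genideal_singleton_iff[OF x0] by blast
  \<comment> \<open>Cancelling \<open>x0\<close> gives \<open>z a = b y\<close>. Regularity of
    \<open>z\<close> modulo \<open>y\<close> makes \<open>a\<close> a multiple of \<open>y\<close>,
    and cancelling \<open>y\<close> puts \<open>w2\<close> into the ideal of
    \<open>x0\<close>.\<close>
  have "x0 \<otimes> (z \<otimes> a) = z \<otimes> (y \<otimes> w2)" using x0 z(1) a y(1) by (simp add: m_ac)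
  also have "\<dots> = y \<otimes> (b \<otimes> x0)" unfolding b(2)[symmetric] using z(1) y(1) w2(1) by (simp add: m_ac)
  also have "\<dots> = x0 \<otimes> (b \<otimes> y)" using x0 b(1) y(1) by (simp add: m_ac)
  finally have "x0 \<otimes> (z \<otimes> a \<ominus> b \<otimes> y) = \<zero>"
    using x0 z(1) y(1) a(1) b(1) by (simp add: minus_eq r_distr r_minus r_neg)
  then have "z \<otimes> a \<ominus> b \<otimes> y = \<zero>" using reg z(1) y(1) a(1) b(1) by simp
  then have "z \<otimes> a = b \<otimes> y" using z(1) y(1) a(1) b(1) by simp
  then have "z \<otimes> a \<in> Idl {y}" using b(1) mem_genideal_singleton_iff[OF y(1)] by blast
  then have "a \<in> Idl {y}" using rz a(1) by blast
  then obtain c where c: "c \<in> carrier R" "a = c \<otimes> y" using mem_genideal_singleton_iff[OF y(1)] by blast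
  have "y \<otimes> (w2 \<ominus> c \<otimes> x0) = \<zero>"
  proof -
    have "y \<otimes> (c \<otimes> x0) = y \<otimes> w2" unfolding a(2) c(2) using x0 y(1) c(1) by (simp add: m_ac)
    then show ?thesis using x0 y(1) c(1) w2(1) by (simp add: minus_eq r_distr r_minus r_neg)
  qed
  then have "w2 \<ominus> c \<otimes> x0 = \<zero>" using ry x0 y(1) c(1) w2(1) by simp
  then have "w2 = c \<otimes> x0" using x0 c(1) w2(1) by simp
  then show False using w2(2) c(1) mem_genideal_singleton_iff[OF x0] by blast
qed

text \<open>\<open>[x0]\<close> is regular, so the empty sequence is not maximal, and
  \<open>no_regular_pair\<close> excludes length two or more. All maximal sequences thus have length
  1, so the definite description denotes.\<close>

lemma (in cring) graded_depth_eq_1: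
  assumes J: "irrelevant_part R gr \<subseteq> carrier R"
    and x0: "x0 \<in> irrelevant_part R gr" and reg: "\<And>a. a \<in> carrier R \<Longrightarrow> x0 \<otimes> a = \<zero> \<Longrightarrow> a = \<zero>"
    and proper: "\<one> \<notin> Idl {x0}"
    and w: "w \<in> carrier R" "w \<notin> Idl {x0}"
    and nil: "\<And>y. y \<in> irrelevant_part R gr \<Longrightarrow> \<exists>n::nat. y [^] n \<otimes> w \<in> Idl {x0}"
  shows "graded_depth R gr = 1"
proof -
  have x0c: "x0 \<in> carrier R" using x0 J by blast
  have no_pair: "\<not> regular_sequence R (y # z # xs)"
    if "y \<in> irrelevant_part R gr" "z \<in> irrelevant_part R gr" for y z xs
    using that J by (intro no_regular_pair[OF x0c reg w] nil) auto
  have regular: "regular_sequence R [x0]"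
    using x0c reg proper genideal_empty by (auto simp: regular_sequence_def)
  then have max: "maximal_regular_sequence_in R (irrelevant_part R gr) [x0]"
    using x0 no_pair by (simp add: maximal_regular_sequence_in_def)
  have uniq: "length xs = 1" if "maximal_regular_sequence_in R (irrelevant_part R gr) xs" for xs
  proof -
    consider "xs = []" | y where "xs = [y]" | y z zs where "xs = y # z # zs"
      by (metis list.exhaust)
    then show ?thesis
    proof cases
      case 1
      then show ?thesis using that regular x0 by (auto simp: maximal_regular_sequence_in_def)
    next
      case 3
      then show ?thesis using that no_pair by (auto simp: maximal_regular_sequence_in_def)
    qed simp
  qed
  show ?thesis unfolding graded_depth_def
    by (rule the_equality) (use max uniq in auto)
qed

section \<open>The cyclic group action\<close>

lemma fixed_vectors_line:
  assumes "t > 0"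
  shows "{v \<in> carrier_vec t. jordan_block t (1::'k::field) *\<^sub>v v = v} = {c \<cdot>\<^sub>v unit_vec t 0 | c. True}"
proof (rule Set.set_eqI, rule iffI)
  fix v :: "'k vec" assume "v \<in> {v \<in> carrier_vec t. jordan_block t 1 *\<^sub>v v = v}"
  then have v: "v \<in> carrier_vec t" "jordan_block t 1 *\<^sub>v v = v" by auto
  have z: "v $ Suc i = 0" if i: "Suc i < t" for i
  proof -
    have "row (jordan_block t (1 :: 'k)) i = unit_vec t i + unit_vec t (Suc i)"
      using i by (intro eq_vecI) (auto simp: jordan_block_index)
    then have "(jordan_block t 1 *\<^sub>v v) $ i = (unit_vec t i + unit_vec t (Suc i)) \<bullet> v"
      using i v(1) by simp
    also have "\<dots> = v $ i + v $ Suc i"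
      using i v(1) by (simp add: add_scalar_prod_distrib[of _ t])
    finally show ?thesis using v(2) by simp
  qed
  have "v = v $ 0 \<cdot>\<^sub>v unit_vec t 0"
  proof (rule eq_vecI)
    fix i assume "i < dim_vec (v $ 0 \<cdot>\<^sub>v unit_vec t 0)"
    then show "v $ i = (v $ 0 \<cdot>\<^sub>v unit_vec t 0) $ i"
      using z by (cases i) simp_all
  qed (use v(1) in simp)
  then show "v \<in> {c \<cdot>\<^sub>v unit_vec t 0 | c. True}" by blast
next
  fix v :: "'k vec" assume "v \<in> {c \<cdot>\<^sub>v unit_vec t 0 | c. True}"
  then obtain c where v: "v = c \<cdot>\<^sub>v unit_vec t 0" by blast
  have "jordan_block t 1 *\<^sub>v unit_vec t 0 = (unit_vec t 0 :: 'k vec)"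
    using assms by (intro eq_vecI) (auto simp: jordan_block_index)
  then show "v \<in> {v \<in> carrier_vec t. jordan_block t 1 *\<^sub>v v = v}"
    unfolding v using mult_mat_vec[of "jordan_block t (1::'k)" t t "unit_vec t 0" c] by simp
qed

lemma dim_line:
  assumes "t > 0"
  shows "vectorspace.dim class_ring ((module_vec TYPE('k::field) t)\<lparr>carrier := {c \<cdot>\<^sub>v unit_vec t 0 | c. True}\<rparr>) = 1"
proof -
  let ?W = "{c \<cdot>\<^sub>v unit_vec t 0 | c. True} :: 'k vec set"
  let ?V = "module_vec TYPE('k) t"
  interpret V: vec_space "TYPE('k)" t .
  have sub: "submodule class_ring ?W ?V"
  proof
    fix v w :: "'k vec" assume "v \<in> ?W" "w \<in> ?W"
    then obtain c d where "v = c \<cdot>\<^sub>v unit_vec t 0" "w = d \<cdot>\<^sub>v unit_vec t 0" by blast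
    then have "v \<oplus>\<^bsub>?V\<^esub> w = (c + d) \<cdot>\<^sub>v unit_vec t 0"
      by (simp add: module_vec_simps add_smult_distrib_vec)
    then show "v \<oplus>\<^bsub>?V\<^esub> w \<in> ?W" by blast
  next
    have "\<zero>\<^bsub>?V\<^esub> = 0 \<cdot>\<^sub>v unit_vec t 0" by (intro eq_vecI) (auto simp: module_vec_simps)
    then show "\<zero>\<^bsub>?V\<^esub> \<in> ?W" by blast
  next
    fix a and v :: "'k vec" assume "v \<in> ?W"
    then obtain c where "v = c \<cdot>\<^sub>v unit_vec t 0" by blast
    then have "a \<odot>\<^bsub>?V\<^esub> v = (a * c) \<cdot>\<^sub>v unit_vec t 0"
      by (simp add: module_vec_simps smult_smult_assoc)
    then show "a \<odot>\<^bsub>?V\<^esub> v \<in> ?W" by blast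
  qed (auto simp: module_vec_simps)
  have "subspace class_ring ?W ?V"
    unfolding subspace_def using sub V.vectorspace_axioms by blast
  then interpret W: vectorspace class_ring "?V\<lparr>carrier := ?W\<rparr>" by (rule V.subspace_is_vs)
  let ?e = "unit_vec t 0 :: 'k vec"
  have e: "?e \<in> ?W" by (rule CollectI, rule exI[of _ 1]) simp
  have "W.span {?e} = ?W"
  proof
    show "?W \<subseteq> W.span {?e}"
    proof
      fix v assume "v \<in> ?W"
      then obtain c where v: "v = c \<cdot>\<^sub>v ?e" by blast
      have "W.lincomb (\<lambda>_. c) {?e} = v"
      proof -
        have "W.lincomb (\<lambda>_. c) {?e} = c \<odot>\<^bsub>?V\<^esub> ?e \<oplus>\<^bsub>?V\<^esub> W.lincomb (\<lambda>_. c) {}"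
          using e unfolding W.lincomb_def by (subst W.finsum_insert) (auto simp: module_vec_simps)
        also have "W.lincomb (\<lambda>_. c) {} = \<zero>\<^bsub>?V\<^esub>"
          unfolding W.lincomb_def by (subst W.finsum_empty) simp
        finally show ?thesis by (simp add: v module_vec_simps)
      qed
      then show "v \<in> W.span {?e}" unfolding W.span_def by (auto simp: class_ring_simps)
    qed
    show "W.span {?e} \<subseteq> ?W" using W.span_is_subset2[of "{?e}"] e by simp
  qed
  moreover have "?e \<noteq> \<zero>\<^bsub>?V\<^esub>"
  proof
    assume "?e = \<zero>\<^bsub>?V\<^esub>"
    then have "?e $ 0 = 0" using assms by (simp add: module_vec_simps)
    then show False using assms by simp
  qed
  ultimately show ?thesis using e by (intro W.dim1I[of ?e]) simp_all
qed


section \<open>Linear substitutions and their matrices\<close>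

lemma lin_comp_mult:
  fixes A B :: "'k::field mat"
  assumes "A \<in> carrier_mat t t" "B \<in> carrier_mat t t" "p \<in> polys t"
  shows "lin_comp t (A * B) p = lin_comp t B (lin_comp t A p)"
  unfolding lin_comp_def subst_subst
proof (rule subst_cong_polys[OF assms(3)])
  interpret c: comm_ring_hom "const :: 'k \<Rightarrow> 'k mpoly" by (rule const_hom)
  fix i assume i: "i < t"
  have "(\<Sum>j<t. const ((A * B) $$ (i, j)) * coord j) = (\<Sum>j<t. \<Sum>l<t. const (A $$ (i, l)) * const (B $$ (l, j)) * coord j)"
    using assms i by (intro sum.cong) (auto simp: scalar_prod_def c.hom_sum atLeast0LessThan sum_distrib_right)
  also have "\<dots> = (\<Sum>l<t. \<Sum>j<t. const (A $$ (i, l)) * const (B $$ (l, j)) * coord j)"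
    by (rule sum.swap)
  also have "\<dots> = subst (\<lambda>i. \<Sum>j<t. const (B $$ (i, j)) * coord j) (\<Sum>j<t. const (A $$ (i, j)) * coord j)"
    by (simp add: subst_sum sum_distrib_left mult.assoc)
  finally show "(\<Sum>j<t. const ((A * B) $$ (i, j)) * coord j)
    = subst (\<lambda>i. \<Sum>j<t. const (B $$ (i, j)) * coord j) (\<Sum>j<t. const (A $$ (i, j)) * coord j)" .
qed

lemma lin_comp_one: "p \<in> polys t \<Longrightarrow> lin_comp t (1\<^sub>m t) p = (p :: 'k::field mpoly)"
  unfolding lin_comp_def
proof (subst subst_cong_polys[where s' = coord])
  fix i assume "i < t"
  then have "(\<Sum>j<t. const (1\<^sub>m t $$ (i, j)) * coord j) = (\<Sum>j<t. if j = i then coord i else (0 :: 'k mpoly))"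
    by (intro sum.cong) auto
  then show "(\<Sum>j<t. const (1\<^sub>m t $$ (i, j)) * coord j) = (coord i :: 'k mpoly)"
    using \<open>i < t\<close> by simp
qed auto

lemma lin_comp_jordan_block: "p \<in> polys t \<Longrightarrow> lin_comp t (jordan_block t 1) p = (shift t 1 p :: 'k::field mpoly)"
  unfolding lin_comp_def shift_def
proof (erule subst_cong_polys)
  fix i assume i: "i < t"
  have "(\<Sum>j<t. const (jordan_block t 1 $$ (i, j)) * coord j)
      = (\<Sum>j<t. (if j = i then coord i else 0) + (if j = Suc i then coord (Suc i) else (0 :: 'k mpoly)))"
    using i by (intro sum.cong) (auto simp: jordan_block_index)
  then show "(\<Sum>j<t. const (jordan_block t 1 $$ (i, j)) * coord j) = coord i + (if i + 1 < t then coord (i + 1) else (0 :: 'k mpoly))"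
    using i by (simp add: sum.distrib)
qed

lemma pd_sum: "pd j (\<Sum>x\<in>A. h x) = (\<Sum>x\<in>A. pd j (h x))"
  by (induction A rule: infinite_finite_induct) auto

lemma lin_comp_determines:
  fixes A B :: "'k::field mat"
  assumes "A \<in> carrier_mat t t" "B \<in> carrier_mat t t"
    and "\<And>i. i < t \<Longrightarrow> lin_comp t A (coord i) = lin_comp t B (coord i)"
  shows "A = B"
proof (rule eq_matI)
  have *: "pd j (lin_comp t C (coord i)) = const (C $$ (i, j))" if "j < t" for C :: "'k mat" and i j
  proof -
    have "pd j (lin_comp t C (coord i)) = (\<Sum>l<t. if l = j then const (C $$ (i, j)) else 0)"
      unfolding lin_comp_def subst_coord pd_sum by (intro sum.cong) (auto simp: pd_mult pd_coord)
    then show ?thesis using that by simp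
  qed
  fix i j assume "i < dim_row B" "j < dim_col B"
  then have "(const (A $$ (i, j)) :: 'k mpoly) = const (B $$ (i, j))"
    using *[of j A i] *[of j B i] assms by simp
  then have "const_term (const (A $$ (i, j)) :: 'k mpoly) = const_term (const (B $$ (i, j)) :: 'k mpoly)" by simp
  then show "A $$ (i, j) = B $$ (i, j)" by (simp only: const_term_simps)
qed (use assms in auto)

lemma shift_polys: "p \<in> polys t \<Longrightarrow> shift t d p \<in> polys t"
  unfolding shift_def by (erule subst_in_polys) (auto intro: polys_add polys_coord)

lemma shift_funpow_polys: "p \<in> polys t \<Longrightarrow> (shift t d ^^ n) p \<in> polys t"
  by (induction n) (auto intro: shift_polys)

section \<open>The cyclic group acting by powers of a Jordan block\<close>

locale jordan_rep = group G for G :: "('g, 'b) monoid_scheme" (structure) +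
  fixes \<sigma> :: 'g and \<rho> :: "'g \<Rightarrow> 'k::field mat" and r t :: nat
  assumes \<sigma>: "\<sigma> \<in> carrier G"
    and gen: "carrier G = generate G {\<sigma>}"
    and order: "order G = 2 ^ r"
    and \<rho>: "\<rho> \<in> hom G (general_linear TYPE('k) t)"
    and \<rho>\<sigma>: "\<rho> \<sigma> = jordan_block t 1"
    and inj: "inj_on \<rho> (carrier G)"
begin

lemma monoid_mat: "monoid (ring_mat TYPE('k) t ())"
proof -
  have "ring (ring_mat TYPE('k) t ())" by (rule ring_mat)
  then show ?thesis by (rule ring.is_monoid)
qed

lemma \<rho>_carrier: "g \<in> carrier G \<Longrightarrow> \<rho> g \<in> carrier_mat t t"
  using hom_in_carrier[OF \<rho>, of g] by (auto simp: units_of_def Units_def ring_mat_simps)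

lemma \<rho>_mult: "g \<in> carrier G \<Longrightarrow> h \<in> carrier G \<Longrightarrow> \<rho> (g \<otimes> h) = \<rho> g * \<rho> h"
  using hom_mult[OF \<rho>, of g h] by (simp add: units_of_def ring_mat_simps)

lemma \<rho>_one: "\<rho> \<one> = 1\<^sub>m t"
  using hom_one[OF \<rho> is_group monoid.units_group[OF monoid_mat]]
  by (simp add: units_of_def ring_mat_simps)

lemma lin_comp_power: "p \<in> polys t \<Longrightarrow> lin_comp t (\<rho> (\<sigma> [^] n)) p = (shift t 1 ^^ n) p"
proof (induction n)
  case 0
  then show ?case by (simp add: \<rho>_one lin_comp_one)
next
  case (Suc n)
  have "lin_comp t (\<rho> (\<sigma> [^] Suc n)) p = lin_comp t (jordan_block t 1) (lin_comp t (\<rho> (\<sigma> [^] n)) p)"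
    using \<sigma> Suc.prems \<rho>_carrier[of "\<sigma> [^] n"] \<rho>_carrier[OF \<sigma>]
    by (simp add: \<rho>_mult \<rho>\<sigma> lin_comp_mult)
  then show ?case using Suc by (simp add: lin_comp_jordan_block shift_funpow_polys)
qed

lemma finite_G: "finite (carrier G)"
  using order by (metis card.infinite order_def power_not_zero zero_neq_numeral)

lemma ord_\<sigma>: "ord \<sigma> = 2 ^ r"
  using generate_pow_card[OF \<sigma>] order by (simp add: gen order_def)

lemma bij_power: "bij_betw (\<lambda>n::nat. \<sigma> [^] n) {..<2 ^ r} (carrier G)"
proof -
  have *: "{0..ord \<sigma> - 1} = {..<2 ^ r}" by (auto simp: ord_\<sigma> less_eq_Suc_le[symmetric]) (metis Suc_pred le_imp_less_Suc pos2 zero_less_power)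
  show ?thesis
    unfolding bij_betw_def
  proof
    show "inj_on (\<lambda>n::nat. \<sigma> [^] n) {..<2 ^ r}" using ord_inj[OF \<sigma>] by (simp only: *)
    show "(\<lambda>n::nat. \<sigma> [^] n) ` {..<2 ^ r} = carrier G"
      using ord_elems[OF finite_G \<sigma>] generate_pow_on_finite_carrier[OF finite_G \<sigma>]
      unfolding * gen[symmetric] by blast
  qed
qed

lemma bij_inv: "bij_betw (\<lambda>g. inv g) (carrier G) (carrier G)"
  by (rule bij_betw_byWitness[where f' = "\<lambda>g. inv g"]) auto

text \<open>Inversion permutes the group, so the inverse in \<open>poly_act\<close> does not affect
  the sum; the elements are then listed as powers of \<open>\<sigma>\<close>.\<close>

lemma transfer_eq:
  assumes "p \<in> polys t"
  shows "transfer G \<rho> t p = (\<Sum>n\<in>{..<2 ^ r :: nat}. (shift t 1 ^^ n) p)"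
proof -
  have "transfer G \<rho> t p = (\<Sum>g\<in>carrier G. lin_comp t (\<rho> g) p)"
    unfolding transfer_def poly_act_def by (rule sum.reindex_bij_betw[OF bij_inv])
  also have "\<dots> = (\<Sum>n\<in>{..<2 ^ r :: nat}. lin_comp t (\<rho> (\<sigma> [^] n)) p)"
    by (rule sum.reindex_bij_betw[OF bij_power, symmetric])
  finally show ?thesis using assms by (simp add: lin_comp_power)
qed

lemma invariants_eq: "invariants G \<rho> t = {p \<in> polys t. shift t 1 p = p}"
proof (intro subset_antisym subsetI)
  fix p assume "p \<in> invariants G \<rho> t"
  then have p: "p \<in> polys t" "\<And>g. g \<in> carrier G \<Longrightarrow> lin_comp t (\<rho> (inv g)) p = p"
    by (auto simp: invariants_def poly_act_def)
  from p(2)[of "inv \<sigma>"] \<sigma> have "lin_comp t (\<rho> \<sigma>) p = p" by simp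
  then show "p \<in> {p \<in> polys t. shift t 1 p = p}" using p(1) by (simp add: \<rho>\<sigma> lin_comp_jordan_block)
next
  fix p :: "'k mpoly" assume p: "p \<in> {p \<in> polys t. shift t 1 p = p}"
  have "poly_act G \<rho> t g p = p" if "g \<in> carrier G" for g
  proof -
    have "inv g \<in> (\<lambda>n::nat. \<sigma> [^] n) ` {..<2 ^ r}" using bij_power that by (simp add: bij_betw_def)
    then obtain n :: nat where n: "inv g = \<sigma> [^] n" by blast
    have "(shift t 1 ^^ n) p = p" using p by (induction n) auto
    then show ?thesis using p by (simp add: poly_act_def n lin_comp_power)
  qed
  then show "p \<in> invariants G \<rho> t" using p by (simp add: invariants_def)
qed

text \<open>Otherwise the power of \<open>\<sigma>\<close> with exponent \<open>2^(r-1)\<close>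
  would act as a shift by at least \<open>t\<close>, hence trivially, although its exponent is below
  the order of \<open>\<sigma>\<close>.\<close>

lemma faithful_dim:
  assumes "CHAR('k) = 2" "r \<ge> 1"
  shows "2 ^ (r - 1) < t"
proof (rule ccontr)
  interpret char_two "TYPE('k)" by unfold_locales (rule assms(1))
  assume "\<not> 2 ^ (r - 1) < t"
  then have le: "t \<le> 2 ^ (r - 1)" by simp
  let ?n = "2 ^ (r - 1) :: nat"
  have "\<rho> (\<sigma> [^] ?n) = 1\<^sub>m t"
  proof (rule lin_comp_determines)
    fix i assume "i < t"
    then have c: "(coord i :: 'k mpoly) \<in> polys t" by (rule polys_coord)
    show "lin_comp t (\<rho> (\<sigma> [^] ?n)) (coord i) = lin_comp t (1\<^sub>m t) (coord i)"
      unfolding lin_comp_power[OF c] lin_comp_one[OF c] shift_power using le by (simp add: shift_large)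
  qed (use \<sigma> \<rho>_carrier in auto)
  then have "\<sigma> [^] ?n = \<one>" using inj \<sigma> \<rho>_one by (auto simp: inj_on_def)
  then have "ord \<sigma> dvd ?n" using pow_eq_id[OF \<sigma>] by blast
  then have "(2::nat) ^ r \<le> 2 ^ (r - 1)" unfolding ord_\<sigma> by (rule dvd_imp_le) simp
  then show False using assms(2) by simp
qed

lemma fixed_dim_eq_1:
  assumes "t > 0"
  shows "fixed_dim G \<rho> t = 1"
proof -
  have "fixed_vectors G \<rho> t = {v \<in> carrier_vec t. jordan_block t 1 *\<^sub>v v = v}"
  proof (intro subset_antisym subsetI)
    fix v assume "v \<in> fixed_vectors G \<rho> t"
    then show "v \<in> {v \<in> carrier_vec t. jordan_block t 1 *\<^sub>v v = v}"
      using \<sigma> \<rho>\<sigma> unfolding fixed_vectors_def by (metis (mono_tags, lifting) mem_Collect_eq)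
  next
    fix v :: "'k vec" assume v: "v \<in> {v \<in> carrier_vec t. jordan_block t 1 *\<^sub>v v = v}"
    have "\<rho> (\<sigma> [^] n) *\<^sub>v v = v" for n :: nat
    proof (induction n)
      case 0
      then show ?case using v by (simp add: \<rho>_one)
    next
      case (Suc n)
      have "\<rho> (\<sigma> [^] Suc n) *\<^sub>v v = \<rho> (\<sigma> [^] n) *\<^sub>v (\<rho> \<sigma> *\<^sub>v v)"
        using \<sigma> v \<rho>_carrier[of "\<sigma> [^] n"] \<rho>_carrier[OF \<sigma>] by (simp add: \<rho>_mult)
      then show ?case using v Suc by (simp add: \<rho>\<sigma>)
    qed
    moreover have "g \<in> (\<lambda>n::nat. \<sigma> [^] n) ` {..<2 ^ r}" if "g \<in> carrier G" for g
      using bij_power that by (simp add: bij_betw_def)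
    ultimately have "\<rho> g *\<^sub>v v = v" if "g \<in> carrier G" for g
      using that by force
    then show "v \<in> fixed_vectors G \<rho> t" using v by (simp add: fixed_vectors_def)
  qed
  then show ?thesis
    unfolding fixed_dim_def using dim_line[OF assms, where 'k = 'k] fixed_vectors_line[OF assms, where 'k = 'k] by simp
qed

end

section \<open>Homogeneous polynomials\<close>

definition mdeg :: "(nat \<Rightarrow>\<^sub>0 nat) \<Rightarrow> nat" where
  "mdeg m = (\<Sum>i\<in>Poly_Mapping.keys m. Poly_Mapping.lookup m i)"

lemma mdeg_superset: "finite A \<Longrightarrow> Poly_Mapping.keys m \<subseteq> A \<Longrightarrow> mdeg m = (\<Sum>i\<in>A. Poly_Mapping.lookup m i)"
  unfolding mdeg_def by (rule sum.mono_neutral_left) (auto simp: in_keys_iff)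

lemma mdeg_add: "mdeg (m + n) = mdeg m + mdeg n"
proof -
  let ?A = "Poly_Mapping.keys m \<union> Poly_Mapping.keys n"
  have "Poly_Mapping.keys (m + n) \<subseteq> ?A" by (rule keys_add)
  then show ?thesis
    by (subst (1 2 3) mdeg_superset[where A = ?A]) (auto simp: lookup_add sum.distrib)
qed

lemma homogeneous_iff: "homogeneous d p \<longleftrightarrow> (\<forall>m\<in>Poly_Mapping.keys p. mdeg m = d)"
  by (simp add: homogeneous_def mdeg_def)

lemma homogeneous_0 [simp]: "homogeneous d 0"
  by (simp add: homogeneous_def)

lemma homogeneous_1: "homogeneous 0 1"
  by (simp add: homogeneous_def)

lemma homogeneous_coord: "homogeneous 1 (coord i)"
  by (simp add: homogeneous_def coord_def)

lemma homogeneous_add: "homogeneous d p \<Longrightarrow> homogeneous d q \<Longrightarrow> homogeneous d (p + q)"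
  using keys_add[of p q] by (auto simp: homogeneous_def)

lemma homogeneous_mult: "homogeneous d p \<Longrightarrow> homogeneous d' q \<Longrightarrow> homogeneous (d + d') (p * q)"
  using keys_mult[of p q] by (fastforce simp: homogeneous_iff mdeg_add)

lemma homogeneous_power: "homogeneous d p \<Longrightarrow> homogeneous (n * d) (p ^ n)"
  by (induction n) (auto intro: homogeneous_1 dest: homogeneous_mult)

lemma homogeneous_prod: "(\<And>x. x \<in> A \<Longrightarrow> homogeneous (d x) (h x)) \<Longrightarrow> homogeneous (\<Sum>x\<in>A. d x) (\<Prod>x\<in>A. h x)"
  by (induction A rule: infinite_finite_induct) (auto intro: homogeneous_1 homogeneous_mult)

lemma homogeneous_sum: "(\<And>x. x \<in> A \<Longrightarrow> homogeneous d (h x)) \<Longrightarrow> homogeneous d (\<Sum>x\<in>A. h x)"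
  by (induction A rule: infinite_finite_induct) (auto intro: homogeneous_add)

lemma homogeneous_const: "homogeneous 0 (const c)"
  by (simp add: homogeneous_def const_def)

lemma homogeneous_subst:
  assumes "homogeneous d p" "\<And>i. homogeneous 1 (s i)"
  shows "homogeneous d (subst s p)"
  unfolding subst_def
proof (rule homogeneous_sum)
  fix m assume m: "m \<in> Poly_Mapping.keys p"
  have "homogeneous (\<Sum>i\<in>Poly_Mapping.keys m. Poly_Mapping.lookup m i * 1) (\<Prod>i\<in>Poly_Mapping.keys m. s i ^ Poly_Mapping.lookup m i)"
    by (intro homogeneous_prod homogeneous_power assms)
  moreover have "(\<Sum>i\<in>Poly_Mapping.keys m. Poly_Mapping.lookup m i * 1) = d"
    using assms(1) m by (simp add: homogeneous_def)
  ultimately show "homogeneous d (const (Poly_Mapping.lookup p m) * (\<Prod>i\<in>Poly_Mapping.keys m. s i ^ Poly_Mapping.lookup m i))"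
    using homogeneous_mult[OF homogeneous_const] by fastforce
qed

lemma homogeneous_shift: "homogeneous d p \<Longrightarrow> homogeneous d (shift t k p)"
  unfolding shift_def by (erule homogeneous_subst) (auto intro: homogeneous_add homogeneous_coord[unfolded One_nat_def])

lemma homogeneous_shift_funpow: "homogeneous d p \<Longrightarrow> homogeneous d ((shift t k ^^ n) p)"
  by (induction n) (auto intro: homogeneous_shift)

lemma const_term_homogeneous: "homogeneous d p \<Longrightarrow> d > 0 \<Longrightarrow> const_term p = 0"
proof (rule ccontr)
  assume p: "homogeneous d p" "d > 0" "const_term p \<noteq> 0"
  then have "0 \<in> Poly_Mapping.keys p" by (simp add: const_term_def in_keys_iff)
  then show False using p by (force simp: homogeneous_def)
qed


section \<open>The quotient by the transfer ideal\<close>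

context jordan_char_two
begin

lemma Tr_in_polys: "p \<in> polys t \<Longrightarrow> Tr p \<in> polys t"
  unfolding Tr_def by (intro polys_sum sg_funpow_polys)

lemma D_Tr: "D (Tr p) = 0"
proof -
  have "D (Tr p) = (D ^^ Suc (N - 1)) p" by (simp add: Tr_eq_D)
  also have "Suc (N - 1) = N" using N_pos by simp
  also have "(D ^^ N) p = 0"
    using D_power[of "Suc (Suc e)" p] by (simp only: N_eq[symmetric] sg_N add_self)
  finally show ?thesis .
qed

lemma sg_eq_iff_D: "sg p = p \<longleftrightarrow> D p = 0"
  by (simp add: D_def add_eq_0_iff')

lemma sg_Tr: "sg (Tr p) = Tr p"
  by (simp add: sg_eq_iff_D D_Tr)

lemma const_term_Tr: "const_term (Tr p) = 0"
proof -
  have "Tr p = D ((D ^^ (N - 2)) p)" using M_ge_2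
    by (simp add: Tr_eq_D N_def Suc_diff_Suc numeral_2_eq_2 flip: funpow.simps(2)[THEN fun_cong, unfolded o_apply])
  then show ?thesis by (simp add: D_def add_self_field)
qed

lemma proj_Tr: "proj (Tr p) = Tr (proj p)"
  by (simp add: Tr_eq_D proj_D_funpow)

lemma homogeneous_nrm: "homogeneous N nrm"
proof -
  have "homogeneous (\<Sum>i<N. 1) (\<Prod>i<N. (sg ^^ i) (coord 0))"
    unfolding sg_def by (intro homogeneous_prod homogeneous_shift_funpow homogeneous_coord)
  then show ?thesis by (simp add: nrm_def)
qed

section \<open>The quotient ring, its grading and its depth\<close>

definition inv_ring :: "'k mpoly ring" where
  "inv_ring = \<lparr>carrier = {p \<in> polys t. sg p = p}, monoid.mult = (*), one = 1, zero = 0, add = (+)\<rparr>"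

definition tr_ideal :: "'k mpoly set" where "tr_ideal = Tr ` polys t"

lemma inv_ring_simps [simp]:
  "carrier inv_ring = {p \<in> polys t. sg p = p}" "monoid.mult inv_ring = (*)" "one inv_ring = 1"
  "zero inv_ring = 0" "add inv_ring = (+)"
  by (simp_all add: inv_ring_def)

lemma cring_inv_ring: "cring inv_ring"
proof (rule cringI)
  show "abelian_group inv_ring"
    by (rule abelian_groupI) (auto simp: add_ac intro: polys_add)
  show "comm_monoid inv_ring"
    by (rule comm_monoidI) (auto simp: mult_ac intro: polys_mult)
qed (auto simp: distrib_right)

text \<open>A preimage found in infinitely many variables can be truncated by
  \<open>proj\<close>.\<close>

lemma tr_ideal_iff: "p \<in> polys t \<Longrightarrow> p \<in> tr_ideal \<longleftrightarrow> (\<exists>g. p = Tr g)"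
proof
  assume p: "p \<in> polys t" "\<exists>g. p = Tr g"
  then obtain g where "p = Tr g" by blast
  then have "p = Tr (proj g)" using proj_polys[OF p(1)] by (simp add: proj_Tr)
  then show "p \<in> tr_ideal" unfolding tr_ideal_def using proj_in_polys by blast
qed (auto simp: tr_ideal_def)

lemma ideal_tr: "ideal tr_ideal inv_ring"
proof -
  interpret cring inv_ring by (rule cring_inv_ring)
  have sub: "tr_ideal \<subseteq> carrier inv_ring"
    by (auto simp: tr_ideal_def Tr_in_polys sg_Tr)
  have minus: "\<ominus>\<^bsub>inv_ring\<^esub> p = p" if "p \<in> carrier inv_ring" for p
    using that by (intro minus_equality) auto
  show ?thesis
  proof (rule idealI)
    show "ring inv_ring" by (rule ring_axioms)
    show "subgroup tr_ideal (add_monoid inv_ring)"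
    proof
      show "tr_ideal \<subseteq> carrier (add_monoid inv_ring)" using sub by simp
      show "x \<otimes>\<^bsub>add_monoid inv_ring\<^esub> y \<in> tr_ideal" if "x \<in> tr_ideal" "y \<in> tr_ideal" for x y
      proof -
        obtain g g' where "x = Tr g" "g \<in> polys t" "y = Tr g'" "g' \<in> polys t"
          using \<open>x \<in> tr_ideal\<close> \<open>y \<in> tr_ideal\<close> unfolding tr_ideal_def by blast
        then have "x + y = Tr (g + g')" "g + g' \<in> polys t" by (simp_all add: Tr_add polys_add)
        then have "x + y \<in> tr_ideal" unfolding tr_ideal_def by blast
        then show ?thesis by simp
      qed
      have "0 = Tr 0" by (simp add: Tr_eq_D)
      then show "\<one>\<^bsub>add_monoid inv_ring\<^esub> \<in> tr_ideal" unfolding tr_ideal_def using polys_0 by auto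
      show "inv\<^bsub>add_monoid inv_ring\<^esub> x \<in> tr_ideal" if "x \<in> tr_ideal" for x
        using minus[of x] sub that by (auto simp: a_inv_def)
    qed
    have mult: "x * a \<in> tr_ideal" if a: "a \<in> tr_ideal" and x: "x \<in> carrier inv_ring" for a x
    proof -
      obtain g where "a = Tr g" "g \<in> polys t" using a unfolding tr_ideal_def by blast
      then have "x * a = Tr (x * g)" "x * g \<in> polys t" using x by (simp_all add: Tr_mult_fixed polys_mult)
      then show ?thesis unfolding tr_ideal_def by blast
    qed
    show "x \<otimes>\<^bsub>inv_ring\<^esub> a \<in> tr_ideal" "a \<otimes>\<^bsub>inv_ring\<^esub> x \<in> tr_ideal"
      if "a \<in> tr_ideal" "x \<in> carrier inv_ring" for a x
      using mult[OF that] by (simp_all add: mult.commute)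
  qed
qed

definition quot :: "'k mpoly set ring" where "quot = inv_ring Quot tr_ideal"

definition cls :: "'k mpoly \<Rightarrow> 'k mpoly set" where "cls p = tr_ideal +>\<^bsub>inv_ring\<^esub> p"

definition gr :: "nat \<Rightarrow> 'k mpoly set set" where
  "gr d = cls ` {p \<in> carrier inv_ring. homogeneous d p}"

lemma cls_hom: "ring_hom_cring inv_ring quot cls"
  using ideal.rcos_ring_hom_cring[OF ideal_tr cring_inv_ring]
  by (simp add: quot_def cls_def[abs_def])

lemma carrier_quot: "carrier quot = cls ` carrier inv_ring"
  by (auto simp: quot_def cls_def FactRing_def A_RCOSETS_def' )

lemma cls_eq_zero_iff:
  assumes "p \<in> carrier inv_ring"
  shows "cls p = \<zero>\<^bsub>quot\<^esub> \<longleftrightarrow> p \<in> tr_ideal"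
proof -
  interpret cring inv_ring by (rule cring_inv_ring)
  interpret I: ideal tr_ideal inv_ring by (rule ideal_tr)
  have "\<zero>\<^bsub>quot\<^esub> = tr_ideal" by (simp add: quot_def FactRing_def)
  then show ?thesis
    using a_coset_join1[of tr_ideal p] a_coset_join2[of p tr_ideal] assms I.a_subgroup
    by (auto simp: cls_def)
qed

lemma cls_eq_iff:
  assumes "p \<in> carrier inv_ring" "q \<in> carrier inv_ring"
  shows "cls p = cls q \<longleftrightarrow> p + q \<in> tr_ideal"
proof -
  interpret h: ring_hom_cring inv_ring quot cls by (rule cls_hom)
  have pq: "p + q \<in> carrier inv_ring" using h.R.add.m_closed[OF assms] by simp
  have add: "cls (a + b) = cls a \<oplus>\<^bsub>quot\<^esub> cls b" if "a \<in> carrier inv_ring" "b \<in> carrier inv_ring" for a b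
    using h.hom_add[OF that] by simp
  have self: "cls q \<oplus>\<^bsub>quot\<^esub> cls q = \<zero>\<^bsub>quot\<^esub>"
    using add[OF assms(2) assms(2)] h.hom_zero by simp
  have cq: "\<ominus>\<^bsub>quot\<^esub> cls q = cls q"
    by (rule h.S.minus_equality[OF self]) (use h.hom_closed assms in auto)
  have "cls p = cls q \<longleftrightarrow> cls p \<oplus>\<^bsub>quot\<^esub> cls q = \<zero>\<^bsub>quot\<^esub>"
  proof
    assume 0: "cls p \<oplus>\<^bsub>quot\<^esub> cls q = \<zero>\<^bsub>quot\<^esub>"
    have "\<ominus>\<^bsub>quot\<^esub> cls q = cls p"
      by (rule h.S.minus_equality[OF 0]) (use h.hom_closed assms in auto)
    then show "cls p = cls q" using cq by simp
  qed (simp add: self)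
  then show ?thesis using cls_eq_zero_iff[OF pq] add[OF assms] self by simp
qed

lemma cls_mult:
  assumes "p \<in> carrier inv_ring" "q \<in> carrier inv_ring"
  shows "cls (p * q) = cls p \<otimes>\<^bsub>quot\<^esub> cls q"
proof -
  interpret h: ring_hom_cring inv_ring quot cls by (rule cls_hom)
  show ?thesis using h.hom_mult[OF assms] by simp
qed

lemma carrier_mult: "p \<in> carrier inv_ring \<Longrightarrow> q \<in> carrier inv_ring \<Longrightarrow> p * q \<in> carrier inv_ring"
  by (simp add: polys_mult)

lemma carrier_power: "p \<in> carrier inv_ring \<Longrightarrow> p ^ n \<in> carrier inv_ring"
  by (simp add: polys_power)

lemma cls_power:
  assumes "p \<in> carrier inv_ring"
  shows "cls (p ^ n) = cls p [^]\<^bsub>quot\<^esub> n"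
proof (induction n)
  case 0
  interpret h: ring_hom_cring inv_ring quot cls by (rule cls_hom)
  show ?case using h.hom_one by simp
next
  case (Suc n)
  have "cls (p ^ n * p) = cls (p ^ n) \<otimes>\<^bsub>quot\<^esub> cls p" using assms carrier_power[OF assms] by (intro cls_mult)
  then show ?case using Suc by (simp add: mult.commute)
qed

lemma nrm_carrier: "nrm \<in> carrier inv_ring"
  by (simp add: nrm_polys sg_nrm)

lemma const_term_nrm: "const_term nrm = 0"
  using homogeneous_nrm N_pos by (rule const_term_homogeneous)

lemma cls_in_principal_iff:
  assumes "p \<in> carrier inv_ring"
  shows "cls p \<in> genideal quot {cls nrm} \<longleftrightarrow> (\<exists>c\<in>carrier inv_ring. p + nrm * c \<in> tr_ideal)"
proof -
  interpret h: ring_hom_cring inv_ring quot cls by (rule cls_hom)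
  have "cls p \<in> genideal quot {cls nrm} \<longleftrightarrow> (\<exists>c\<in>carrier inv_ring. cls p = cls c \<otimes>\<^bsub>quot\<^esub> cls nrm)"
    using h.S.mem_genideal_singleton_iff[OF h.hom_closed[OF nrm_carrier]] by (simp add: carrier_quot)
  also have "\<dots> \<longleftrightarrow> (\<exists>c\<in>carrier inv_ring. p + nrm * c \<in> tr_ideal)"
  proof (rule bex_cong)
    fix c assume c: "c \<in> carrier inv_ring"
    show "cls p = cls c \<otimes>\<^bsub>quot\<^esub> cls nrm \<longleftrightarrow> p + nrm * c \<in> tr_ideal"
      using cls_eq_iff[OF assms carrier_mult[OF nrm_carrier c]] cls_mult[OF c nrm_carrier] by (simp add: mult.commute)
  qed simp
  finally show ?thesis .
qed

text \<open>Components of positive degree have representatives without constant term, the form in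
  which \<open>witness_killed\<close> applies to them.\<close>

lemma irrelevant_quot:
  assumes "x \<in> irrelevant_part quot gr"
  obtains p where "p \<in> carrier inv_ring" "const_term p = 0" "x = cls p"
proof -
  interpret h: ring_hom_cring inv_ring quot cls by (rule cls_hom)
  obtain a n where x: "x = finsum quot a {1..n}" and a: "\<forall>i\<in>{1..n}. a i \<in> gr i"
    using assms unfolding irrelevant_part_def by blast
  have "finite S \<Longrightarrow> S \<subseteq> {1..n} \<Longrightarrow> \<exists>p\<in>carrier inv_ring. const_term p = 0 \<and> finsum quot a S = cls p" for S
  proof (induction S rule: finite_induct)
    case empty
    show ?case using h.hom_zero h.R.zero_closed by (intro bexI[of _ 0]) simp_all
  next
    case (insert i S)
    then obtain p where p: "p \<in> carrier inv_ring" "const_term p = 0" "finsum quot a S = cls p" by blast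
    have i: "i \<in> {1..n}" using insert.prems by blast
    then obtain q where q: "q \<in> carrier inv_ring" "homogeneous i q" "a i = cls q"
      using a unfolding gr_def by blast
    have "const_term q = 0" using const_term_homogeneous[OF q(2)] i by simp
    moreover have "a \<in> S \<rightarrow> carrier quot"
      using a insert.prems unfolding gr_def carrier_quot by blast
    then have "finsum quot a (insert i S) = cls q \<oplus>\<^bsub>quot\<^esub> cls p"
      using insert.hyps q p h.hom_closed by (simp add: h.S.finsum_insert del: inv_ring_simps)
    then have "finsum quot a (insert i S) = cls (q + p)" using h.hom_add[OF q(1) p(1)] by simp
    moreover have "q + p \<in> carrier inv_ring" using h.R.add.m_closed[OF q(1) p(1)] by simp
    ultimately show ?case using p(2) by (intro bexI[of _ "q + p"]) simp_all
  qed
  from this[of "{1..n}"] x that show ?thesis by auto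
qed

lemma nrm_irrelevant: "cls nrm \<in> irrelevant_part quot gr"
proof -
  interpret h: ring_hom_cring inv_ring quot cls by (rule cls_hom)
  define a where "a i = (if N = i then cls nrm else \<zero>\<^bsub>quot\<^esub>)" for i
  have "a i \<in> gr i" for i
  proof (cases "N = i")
    case True
    then show ?thesis using nrm_carrier homogeneous_nrm by (auto simp: a_def gr_def)
  next
    case False
    have "cls 0 \<in> gr i" unfolding gr_def using h.R.zero_closed by (intro imageI) simp
    then show ?thesis using False h.hom_zero by (simp add: a_def)
  qed
  moreover have "finsum quot a {1..N} = cls nrm"
    unfolding a_def using N_pos h.hom_closed[OF nrm_carrier]
    by (intro h.S.finsum_singleton[of N "{1..N}" "\<lambda>_. cls nrm"]) auto
  ultimately show ?thesis unfolding irrelevant_part_def by blast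
qed

text \<open>The class of \<open>nrm\<close> serves as the regular element of
  \<open>graded_depth_eq_1\<close>, and that of \<open>D^(N-2) h\<close> as
  \<open>w\<close>.\<close>

lemma graded_depth_quot: "graded_depth quot gr = 1"
proof -
  interpret h: ring_hom_cring inv_ring quot cls by (rule cls_hom)
  obtain h where h: "h \<in> polys t" "Tr h = 0" "\<And>a g. (D ^^ (N - 2)) h \<noteq> nrm * a + Tr g"
    by (rule ex_witness) blast
  define w where "w = (D ^^ (N - 2)) h"
  have "w \<in> polys t"
    using proj_in_polys[of w] proj_polys[OF h(1)] by (simp add: w_def proj_D_funpow)
  moreover have "N - 1 = Suc (N - 2)" using M_ge_2 by (simp add: N_def)
  then have "D w = 0" using h(2) by (simp add: w_def Tr_eq_D)
  ultimately have w: "w \<in> carrier inv_ring" by (simp add: sg_eq_iff_D)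
  show ?thesis
  proof (rule h.S.graded_depth_eq_1)
    show "irrelevant_part quot gr \<subseteq> carrier quot"
      using irrelevant_quot h.hom_closed by blast
    show "cls nrm \<in> irrelevant_part quot gr" by (rule nrm_irrelevant)
    show "a = \<zero>\<^bsub>quot\<^esub>" if a: "a \<in> carrier quot" "cls nrm \<otimes>\<^bsub>quot\<^esub> a = \<zero>\<^bsub>quot\<^esub>" for a
    proof -
      obtain p where p: "p \<in> carrier inv_ring" "a = cls p" using a(1) unfolding carrier_quot by blast
      have "cls (nrm * p) = \<zero>\<^bsub>quot\<^esub>" using a(2) p cls_mult[OF nrm_carrier p(1)] by simp
      then have "nrm * p \<in> tr_ideal" using cls_eq_zero_iff[OF carrier_mult[OF nrm_carrier p(1)]] by blast
      then obtain g where "nrm * p = Tr g" unfolding tr_ideal_def by blast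
      then have "\<exists>g'. p = Tr g'" by (rule nrm_regular)
      then have "p \<in> tr_ideal" using p(1) tr_ideal_iff by simp
      then show ?thesis using cls_eq_zero_iff[OF p(1)] p(2) by simp
    qed
    show "\<one>\<^bsub>quot\<^esub> \<notin> genideal quot {cls nrm}"
    proof
      assume one: "\<one>\<^bsub>quot\<^esub> \<in> genideal quot {cls nrm}"
      have "\<one>\<^bsub>quot\<^esub> = cls 1" using h.hom_one by simp
      moreover have "1 \<in> carrier inv_ring" using h.R.one_closed by simp
      ultimately obtain c where "1 + nrm * c \<in> tr_ideal"
        using one cls_in_principal_iff[of 1] by (auto simp del: inv_ring_simps)
      then obtain g where "1 + nrm * c = Tr g" unfolding tr_ideal_def by blast
      then have "const_term (1 + nrm * c) = const_term (Tr g)" by (rule arg_cong)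
      then show False by (simp add: const_term_Tr const_term_nrm)
    qed
    show "cls w \<in> carrier quot" using w by (rule h.hom_closed)
    show "cls w \<notin> genideal quot {cls nrm}"
    proof
      assume "cls w \<in> genideal quot {cls nrm}"
      then obtain c where "w + nrm * c \<in> tr_ideal" using cls_in_principal_iff[OF w] by blast
      then obtain g where "w + nrm * c = Tr g" unfolding tr_ideal_def by blast
      then have "w = nrm * c + Tr g" by (simp add: add_eq_iff add.commute)
      then show False using h(3) unfolding w_def by blast
    qed
    show "\<exists>n::nat. x [^]\<^bsub>quot\<^esub> n \<otimes>\<^bsub>quot\<^esub> cls w \<in> genideal quot {cls nrm}"
      if x: "x \<in> irrelevant_part quot gr" for x
    proof -
      obtain p where p: "p \<in> carrier inv_ring" "const_term p = 0" "x = cls p"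
        by (rule irrelevant_quot[OF x])
      have "p \<in> polys t" "sg p = p" using p(1) by simp_all
      then obtain n c g where c: "sg c = c" and eq: "p ^ n * w = nrm * c * w + Tr g"
        using witness_killed[OF h(2) _ _ p(2)] unfolding w_def by blast
      have pw: "p ^ n * w \<in> carrier inv_ring" using p(1) w by (intro carrier_mult carrier_power)
      \<comment> \<open>\<open>c\<close> and \<open>g\<close> may involve variables outside
        \<open>polys t\<close>; truncation fixes \<open>p\<close>, \<open>w\<close> and
        \<open>nrm\<close>.\<close>
      have "proj (p ^ n * w) = proj (nrm * c * w + Tr g)" by (rule arg_cong[OF eq])
      then have eq': "p ^ n * w = nrm * (proj c * w) + Tr (proj g)"
        using proj_polys[of "p ^ n * w"] pw proj_polys[OF nrm_polys] proj_polys[of w] w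
        by (simp add: proj_Tr mult.assoc)
      have cw: "proj c * w \<in> carrier inv_ring"
        using w c by (intro carrier_mult) (simp_all add: proj_in_polys flip: proj_sg)
      have "p ^ n * w + nrm * (proj c * w) = Tr (proj g)"
        unfolding eq' by (simp add: add.commute)
      then have "p ^ n * w + nrm * (proj c * w) \<in> tr_ideal"
        unfolding tr_ideal_def using proj_in_polys by blast
      then have "cls (p ^ n * w) \<in> genideal quot {cls nrm}"
        using cls_in_principal_iff[OF pw] cw by blast
      then have "x [^]\<^bsub>quot\<^esub> n \<otimes>\<^bsub>quot\<^esub> cls w \<in> genideal quot {cls nrm}"
        using p(3) cls_mult[OF carrier_power[OF p(1)] w] cls_power[OF p(1)] by simp
      then show ?thesis by blast
    qed
  qed
qed

end

theorem corollary7: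
  fixes G :: "('g, 'b) monoid_scheme"
    and \<sigma> :: 'g
    and \<rho> :: "'g \<Rightarrow> 'k::field mat"
    and r t :: nat
  assumes "infinite (UNIV :: 'k set)"
    and "CHAR('k) = 2"
    and "r \<ge> 1"
    and "group G"
    and "\<sigma> \<in> carrier G"
    and "carrier G = generate G {\<sigma>}"
    and "order G = 2 ^ r"
    and "t \<le> 2 ^ r"
    and "odd t"
    and "\<rho> \<in> hom G (general_linear TYPE('k) t)"
    and "\<rho> \<sigma> = jordan_block t 1"
    and "inj_on \<rho> (carrier G)"
  shows "graded_depth (transfer_quotient G \<rho> t) (transfer_quotient_grading G \<rho> t)
           = fixed_dim G \<rho> t"
proof -
  interpret R: jordan_rep G \<sigma> \<rho> r t
    using assms(4-7,10-12) by (simp add: jordan_rep_def jordan_rep_axioms_def)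
  have tM: "2 ^ (r - 1) < t" using assms(2,3) by (rule R.faithful_dim)
  \<comment> \<open>For \<open>r = 1\<close> the bounds on \<open>t\<close> would force the even
    value 2. So \<open>e = r - 2\<close> is the true difference.\<close>
  have "r \<noteq> 1"
  proof
    assume "r = 1"
    then have "t = 2" using tM assms(8) by simp
    then show False using assms(9) by simp
  qed
  define e where "e = r - 2"
  have r: "r = Suc (Suc e)" using \<open>r \<noteq> 1\<close> assms(3) by (simp add: e_def)
  define f where "f = t - 2 ^ Suc e"
  have t: "t = 2 ^ Suc e + f" using tM by (simp add: f_def r)
  have "odd f" using assms(9) unfolding t by simp
  \<comment> \<open>Parity excludes the regular representation \<open>t = 2^r\<close>, which makes
    the bound on \<open>f\<close> strict.\<close>
  moreover have "t \<noteq> 2 ^ r" using assms(9) by (auto simp: r)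
  then have "f < 2 ^ Suc e" using assms(8) unfolding t r by simp
  ultimately interpret J: jordan_char_two "TYPE('k)" e f
    by unfold_locales (rule assms(2))
  have Jt: "J.t = t" by (simp add: J.t_def J.M_eq t)
  have Jsg: "J.sg = shift t 1" by (simp add: J.sg_def Jt)
  have JN: "J.N = 2 ^ r" by (simp add: J.N_eq r)
  have inv: "invariant_ring G \<rho> t = J.inv_ring"
    by (simp add: invariant_ring_def J.inv_ring_def R.invariants_eq Jt Jsg)
  have tr: "transfer G \<rho> t ` polys t = J.tr_ideal"
    unfolding J.tr_ideal_def Jt
    by (rule image_cong) (simp_all add: R.transfer_eq J.Tr_def JN Jsg)
  have quot: "transfer_quotient G \<rho> t = J.quot"
    by (simp add: transfer_quotient_def J.quot_def inv tr)
  have "invariants G \<rho> t = carrier J.inv_ring"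
    by (simp add: R.invariants_eq Jt Jsg)
  then have gr: "transfer_quotient_grading G \<rho> t = J.gr"
    by (simp add: fun_eq_iff transfer_quotient_grading_def J.gr_def J.cls_def inv tr)
  show ?thesis
    unfolding quot gr J.graded_depth_quot using R.fixed_dim_eq_1 tM by simp
qed

end
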